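(* Let $p\in(0,1)$ and $\alpha=2p-1$. Let $\{m_n:n\in\mathbb{N}\}$ be a sequence of positive integers with $1\le m_n\le n$ for each $n\in\mathbb{N}$, $\lim_{n\to\infty}m_n=+\infty$, and, with $\gamma_n:=m_n/n$, $\lim_{n\to\infty}\gamma_n=\gamma\in[0,1]$. Let $\{T_n\}$ be the elephant random walk in the triangular array setting (defined in the context). Then $$\lim_{n\to\infty}\frac{T_n}{n}=0\quad\text{a.s.}$$ Moreover, the following sharper result holds: if $c\in(\max\{\alpha,1/2\},1)$ then $$\lim_{n\to\infty}\frac{\gamma_nT_n}{(m_n)^c}=0\quad\text{a.s.}$$
   Context: Elephant random walk (ERW). Let $p\in(0,1)$, $s\in[0,1]$, $\alpha=2p-1$. Let $X_1=+1$ with probability $s$ and $X_1=-1$ with probability $1-s$. Let $\{U_n:n\ge1\}$ be independent random variables, independent of $X_1$, with $U_n$ uniform on $\{1,\dots,n\}$, and for $n\in\mathbb{N}=\{1,2,\dots\}$ let $X_{n+1}=+X_{U_n}$ with probability $p$ and $X_{n+1}=-X_{U_n}$ with probability $1-p$ (the sign choices being independent of each other and of everything else). Triangular array setting. Given $\{m_n\}$ with $1\le m_n\le n$, for each $n$ and $1\le k\le n$ let $Y^{(n)}_k=X_k$ for $1\le k\le m_n$ and $Y^{(n)}_k=X^{(n)}_k$ for $m_n<k\le n$, where for $m_n<k\le n$, $X^{(n)}_k=+X_{U_{k,n}}$ with probability $p$ and $X^{(n)}_k=-X_{U_{k,n}}$ with probability $1-p$. Here $\mathcal{U}_n=\{U_{k,n}:m_n<k\le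 n\}$ is an i.i.d. collection of uniform random variables on $\{1,\dots,m_n\}$, and the collections $\mathcal{U}_n$, $n\in\mathbb{N}$, are independent (of each other and of $\{X_i\}$); the sign choices are again independent of each other and of everything else. Define $T_n:=\sum_{k=1}^nY^{(n)}_k$. *)

theory Defs
  imports "HOL-Probability.Probability"
begin

definition sign_pmf :: "real \<Rightarrow> int pmf" where
  "sign_pmf q = map_pmf (\<lambda>b. if b then 1 else - 1) (bernoulli_pmf q)"

text \<open>Labels of the primitive random variables: the first step, the memory picks and signs of
  the walk, and the memory picks and signs of the array (row first, then position).\<close>
datatype source = Start | Pick nat | Sign nat | Row_Pick nat nat | Row_Sign nat nat

definition sources :: "(nat \<Rightarrow> nat) \<Rightarrow> source set" where
  "sources m = {Start} \<union> {Pick n |n. n \<ge> 1} \<union> {Sign n |n. n \<ge> 1}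
     \<union> {Row_Pick n k |n k. n \<ge> 1 \<and> m n < k \<and> k \<le> n}
     \<union> {Row_Sign n k |n k. n \<ge> 1 \<and> m n < k \<and> k \<le> n}"

text \<open>All primitive variables are viewed as integer-valued, so that their joint independence is
  one instance of \<^const>\<open>prob_space.indep_vars\<close>.\<close>
primrec source_var ::
  "(nat \<Rightarrow> 'a \<Rightarrow> int) \<Rightarrow> (nat \<Rightarrow> 'a \<Rightarrow> nat) \<Rightarrow> (nat \<Rightarrow> 'a \<Rightarrow> int) \<Rightarrow>
   (nat \<Rightarrow> nat \<Rightarrow> 'a \<Rightarrow> nat) \<Rightarrow> (nat \<Rightarrow> nat \<Rightarrow> 'a \<Rightarrow> int) \<Rightarrow> source \<Rightarrow> 'a \<Rightarrow> int"
where
  "source_var X U \<epsilon> V \<delta> Start = X 1"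
| "source_var X U \<epsilon> V \<delta> (Pick n) = (\<lambda>\<omega>. int (U n \<omega>))"
| "source_var X U \<epsilon> V \<delta> (Sign n) = \<epsilon> n"
| "source_var X U \<epsilon> V \<delta> (Row_Pick n k) = (\<lambda>\<omega>. int (V n k \<omega>))"
| "source_var X U \<epsilon> V \<delta> (Row_Sign n k) = \<delta> n k"

text \<open>The walk is \<open>X\<close>, with memory \<open>U\<close> and signs \<open>\<epsilon>\<close>; \<open>V n k\<close> is the
  uniform pick from \<open>{1..m n}\<close> at position \<open>k\<close> of row \<open>n\<close> (written $U_{k,n}$ on paper), and
  \<open>\<delta> n k\<close> the corresponding sign. The recursion for \<open>X\<close> holds only almost everywhere because
  \<open>U n\<close> lies in \<open>{1..n}\<close> only almost surely. The value \<open>X 0\<close> plays no role.\<close>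
locale elephant_array = prob_space M
  for M :: "'a measure" and p s :: real and m :: "nat \<Rightarrow> nat"
    and X :: "nat \<Rightarrow> 'a \<Rightarrow> int"
    and U :: "nat \<Rightarrow> 'a \<Rightarrow> nat" and \<epsilon> :: "nat \<Rightarrow> 'a \<Rightarrow> int"
    and V :: "nat \<Rightarrow> nat \<Rightarrow> 'a \<Rightarrow> nat" and \<delta> :: "nat \<Rightarrow> nat \<Rightarrow> 'a \<Rightarrow> int" +
  assumes X_measurable: "k \<ge> 1 \<Longrightarrow> random_variable (count_space UNIV) (X k)"
    and distr_X1: "distr M (count_space UNIV) (X 1) = measure_pmf (sign_pmf s)"
    and distr_U: "n \<ge> 1 \<Longrightarrow> distr M (count_space UNIV) (U n) = measure_pmf (pmf_of_set {1..n})"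
    and distr_\<epsilon>: "n \<ge> 1 \<Longrightarrow> distr M (count_space UNIV) (\<epsilon> n) = measure_pmf (sign_pmf p)"
    and distr_V: "\<lbrakk>n \<ge> 1; m n < k; k \<le> n\<rbrakk> \<Longrightarrow>
      distr M (count_space UNIV) (V n k) = measure_pmf (pmf_of_set {1..m n})"
    and distr_\<delta>: "\<lbrakk>n \<ge> 1; m n < k; k \<le> n\<rbrakk> \<Longrightarrow>
      distr M (count_space UNIV) (\<delta> n k) = measure_pmf (sign_pmf p)"
    and indep_sources:
      "indep_vars (\<lambda>_. count_space UNIV) (source_var X U \<epsilon> V \<delta>) (sources m)"
    and X_step: "n \<ge> 1 \<Longrightarrow> AE \<omega> in M. X (n + 1) \<omega> = \<epsilon> n \<omega> * X (U n \<omega>) \<omega>"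

definition array_step ::
  "(nat \<Rightarrow> nat) \<Rightarrow> (nat \<Rightarrow> 'a \<Rightarrow> int) \<Rightarrow> (nat \<Rightarrow> nat \<Rightarrow> 'a \<Rightarrow> nat) \<Rightarrow> (nat \<Rightarrow> nat \<Rightarrow> 'a \<Rightarrow> int) \<Rightarrow>
   nat \<Rightarrow> nat \<Rightarrow> 'a \<Rightarrow> int"
where
  "array_step m X V \<delta> n k \<omega> = (if k \<le> m n then X k \<omega> else \<delta> n k \<omega> * X (V n k \<omega>) \<omega>)"

definition array_walk ::
  "(nat \<Rightarrow> nat) \<Rightarrow> (nat \<Rightarrow> 'a \<Rightarrow> int) \<Rightarrow> (nat \<Rightarrow> nat \<Rightarrow> 'a \<Rightarrow> nat) \<Rightarrow> (nat \<Rightarrow> nat \<Rightarrow> 'a \<Rightarrow> int) \<Rightarrow>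
   nat \<Rightarrow> 'a \<Rightarrow> int"
where
  "array_walk m X V \<delta> n \<omega> = (\<Sum>k=1..n. array_step m X V \<delta> n k \<omega>)"

end

theory Submission
  imports Defs "HOL-Real_Asymp.Real_Asymp"
begin

text \<open>Write \<open>S n\<close> for the walk, \<open>a = 2 * p - 1\<close>, and split row \<open>n\<close> of the array as
  \<open>T n = D n + (1 + a * (n - m n) / m n) * S (m n)\<close>. Given the walk, the steps of the row beyond
  \<open>m n\<close> are signs with mean \<open>a * S (m n) / m n\<close>, so \<open>D n\<close> is the centred noise of the row. After
  multiplication with \<open>m n / n\<close> the coefficient of \<open>S (m n)\<close> is a convex combination of \<open>1\<close> and
  \<open>a\<close>, so it suffices that, almost surely, \<open>S k / k powr c\<close> tends to \<open>0\<close> and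
  \<open>D n / (n * m n powr (c - 1))\<close> tends to \<open>0\<close>. The separation matters: when \<open>m n\<close> grows slowly
  the same value of \<open>S\<close> serves many rows, and a union bound over rows is affordable only for the
  noise.

  Both limits come from Gaussian bounds on moment generating functions and the Borel-Cantelli lemma
  (\<open>subgaussian_AE_tendsto_0\<close>). The bounds rest on one inequality (\<open>memory_step\<close>): a step taken from
  a memory of \<open>k\<close> signs with sum \<open>s\<close> is a sign with mean \<open>a * s / k\<close>, and by Hoeffding's lemma its
  moment generating function is at most \<open>exp (l\<^sup>2 / 2 + l * a * s / k)\<close>. For the walk, where
  \<open>k = n\<close> and \<open>s = S n\<close>, the linear term turns the parameter \<open>l\<close> into \<open>l * (1 + a / n)\<close>. Iterating,
  \<open>S n\<close> is subgaussian with a variance proxy \<open>v n\<close> satisfying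
  \<open>v (n + 1) = 1 + (1 + a / n)\<^sup>2 * v n\<close>, which grows at most like \<open>n powr d\<close> for each
  \<open>d > max 1 (2 * a)\<close> (\<open>walk_mgf\<close>, \<open>variance_proxy_growth\<close>). Every \<open>c > max a (1/2)\<close> leaves room for
  such a \<open>d\<close> below \<open>2 * c\<close>, so the tails at level \<open>n powr c\<close> are summable without a maximal
  inequality. For the row, the linear terms are exactly the conditional means removed in \<open>D n\<close>,
  and \<open>D n\<close> is subgaussian with variance proxy \<open>n\<close> (\<open>row_noise_mgf\<close>).\<close>

section \<open>Quantities determined by finitely many independent sources\<close>

text \<open>Almost everywhere, and through an arbitrary function: the walk satisfies its recursion only almost
  everywhere, and for finitely many countably valued sources every function is measurable, so that
  no generated sigma-algebra is needed.\<close>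
definition (in prob_space) determined_by :: "('i \<Rightarrow> 'a \<Rightarrow> 'c) \<Rightarrow> 'i set \<Rightarrow> ('a \<Rightarrow> 'b) \<Rightarrow> bool" where
  "determined_by Z A Y \<longleftrightarrow> (\<exists>f. AE \<omega> in M. Y \<omega> = f (restrict (\<lambda>i. Z i \<omega>) A))"

context prob_space
begin

lemma determined_by_mono:
  assumes "determined_by Z A Y" "A \<subseteq> B"
  shows "determined_by Z B Y"
proof -
  from assms(1) obtain f where f: "AE \<omega> in M. Y \<omega> = f (restrict (\<lambda>i. Z i \<omega>) A)"
    unfolding determined_by_def by blast
  have "restrict (restrict (\<lambda>i. Z i \<omega>) B) A = restrict (\<lambda>i. Z i \<omega>) A" for \<omega>
    using assms(2) by (simp add: restrict_restrict Int_absorb1)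
  with f show ?thesis
    unfolding determined_by_def by (intro exI[of _ "\<lambda>z. f (restrict z A)"]) simp
qed

lemma determined_by_source: "i \<in> A \<Longrightarrow> determined_by Z A (\<lambda>\<omega>. g (Z i \<omega>))"
  unfolding determined_by_def by (intro exI[of _ "\<lambda>z. g (z i)"]) simp

lemma determined_by_cong_AE:
  assumes "determined_by Z A Y" "AE \<omega> in M. W \<omega> = Y \<omega>"
  shows "determined_by Z A W"
proof -
  from assms(1) obtain f where "AE \<omega> in M. Y \<omega> = f (restrict (\<lambda>i. Z i \<omega>) A)"
    unfolding determined_by_def by blast
  with assms(2) have "AE \<omega> in M. W \<omega> = f (restrict (\<lambda>i. Z i \<omega>) A)"
    by eventually_elim simp
  then show ?thesis
    unfolding determined_by_def by blast
qed

lemma determined_by_family: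
  assumes "countable I" "\<And>i. i \<in> I \<Longrightarrow> determined_by Z A (Y i)"
  shows "determined_by Z A (\<lambda>\<omega>. restrict (\<lambda>i. Y i \<omega>) I)"
proof -
  from assms(2) obtain f where
    f: "\<And>i. i \<in> I \<Longrightarrow> AE \<omega> in M. Y i \<omega> = f i (restrict (\<lambda>i. Z i \<omega>) A)"
    unfolding determined_by_def by metis
  have "AE \<omega> in M. \<forall>i\<in>I. Y i \<omega> = f i (restrict (\<lambda>i. Z i \<omega>) A)"
    using f assms(1) by (simp add: AE_ball_countable)
  then have "AE \<omega> in M. restrict (\<lambda>i. Y i \<omega>) I = (\<lambda>i\<in>I. f i (restrict (\<lambda>i. Z i \<omega>) A))"
    by eventually_elim (simp cong: restrict_cong)
  then show ?thesis
    unfolding determined_by_def by (intro exI[of _ "\<lambda>z. \<lambda>i\<in>I. f i z"])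
qed

lemma determined_by_comp:
  assumes "determined_by Z A Y"
  shows "determined_by Z A (\<lambda>\<omega>. g (Y \<omega>))"
proof -
  from assms obtain f where "AE \<omega> in M. Y \<omega> = f (restrict (\<lambda>i. Z i \<omega>) A)"
    unfolding determined_by_def by blast
  then have "AE \<omega> in M. g (Y \<omega>) = g (f (restrict (\<lambda>i. Z i \<omega>) A))"
    by eventually_elim simp
  then show ?thesis
    unfolding determined_by_def by (intro exI[of _ "\<lambda>z. g (f z)"])
qed

lemma determined_by_comp2:
  assumes "determined_by Z A Y" "determined_by Z A W"
  shows "determined_by Z A (\<lambda>\<omega>. g (Y \<omega>) (W \<omega>))"
proof -
  from assms obtain f h where "AE \<omega> in M. Y \<omega> = f (restrict (\<lambda>i. Z i \<omega>) A)"
      "AE \<omega> in M. W \<omega> = h (restrict (\<lambda>i. Z i \<omega>) A)"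
    unfolding determined_by_def by blast
  then have "AE \<omega> in M. g (Y \<omega>) (W \<omega>) = g (f (restrict (\<lambda>i. Z i \<omega>) A)) (h (restrict (\<lambda>i. Z i \<omega>) A))"
    by eventually_elim simp
  then show ?thesis
    unfolding determined_by_def by (intro exI[of _ "\<lambda>z. g (f z) (h z)"])
qed

text \<open>Both factors can be replaced by functions of two disjoint blocks of independent sources.\<close>
lemma expectation_mult_determined:
  fixes Z :: "'i \<Rightarrow> 'a \<Rightarrow> 'c :: countable" and F G :: "'a \<Rightarrow> real"
  assumes ind: "indep_vars (\<lambda>_. count_space UNIV) Z I"
    and AB: "finite A" "finite B" "A \<subseteq> I" "B \<subseteq> I" "A \<inter> B = {}"
    and det: "determined_by Z A F" "determined_by Z B G"
    and int: "integrable M F" "integrable M G"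
  shows "expectation (\<lambda>\<omega>. F \<omega> * G \<omega>) = expectation F * expectation G"
proof -
  from det obtain f g where fg: "AE \<omega> in M. F \<omega> = f (restrict (\<lambda>i. Z i \<omega>) A)"
      "AE \<omega> in M. G \<omega> = g (restrict (\<lambda>i. Z i \<omega>) B)"
    unfolding determined_by_def by blast
  let ?zA = "\<lambda>\<omega>. restrict (\<lambda>i. Z i \<omega>) A" and ?zB = "\<lambda>\<omega>. restrict (\<lambda>i. Z i \<omega>) B"
  let ?C = "\<lambda>_. count_space (UNIV :: 'c set)"
  have iv: "indep_var (PiM A ?C) ?zA (PiM B ?C) ?zB"
    using AB by (intro indep_var_restrict[OF ind]) auto
  \<comment> \<open>A finite product of countable discrete spaces is discrete, so every function is measurable.\<close>
  have meas: "h \<in> borel_measurable (PiM J ?C)" if "finite J" for h :: "_ \<Rightarrow> real" and J :: "'i set"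
    using that by (simp add: count_space_PiM_finite)
  have iv': "indep_var borel (f \<circ> ?zA) borel (g \<circ> ?zB)"
    using iv by (rule indep_var_compose) (use meas AB in auto)
  have m: "f \<circ> ?zA \<in> borel_measurable M" "g \<circ> ?zB \<in> borel_measurable M"
    using indep_var_rv1[OF iv'] indep_var_rv2[OF iv'] by auto
  have fi: "integrable M (f \<circ> ?zA)"
    by (subst integrable_cong_AE[of _ _ F]) (use fg m int in \<open>auto simp: o_def\<close>)
  have gi: "integrable M (g \<circ> ?zB)"
    by (subst integrable_cong_AE[of _ _ G]) (use fg m int in \<open>auto simp: o_def\<close>)
  have "expectation (\<lambda>\<omega>. F \<omega> * G \<omega>) = expectation (\<lambda>\<omega>. (f \<circ> ?zA) \<omega> * (g \<circ> ?zB) \<omega>)"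
    using int m fg by (intro integral_cong_AE) (auto simp: o_def)
  also have "\<dots> = expectation (f \<circ> ?zA) * expectation (g \<circ> ?zB)"
    by (rule indep_var_lebesgue_integral[OF iv' fi gi])
  also have "expectation (f \<circ> ?zA) = expectation F"
    using int m fg by (intro integral_cong_AE) (auto simp: o_def)
  also have "expectation (g \<circ> ?zB) = expectation G"
    using int m fg by (intro integral_cong_AE) (auto simp: o_def)
  finally show ?thesis .
qed

end

section \<open>A step drawn from a memory of signs\<close>

text \<open>The left-hand side is the moment generating function of a sign with mean \<open>y\<close>, so this is
  Hoeffding's lemma for that sign, with the mean kept on the right. The estimate behind
  Hoeffding's lemma covers nonnegative \<open>l\<close>; a change of both signs gives the rest.\<close>
lemma cosh_add_sinh_le_exp:
  fixes l y :: real
  assumes "\<bar>y\<bar> \<le> 1"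
  shows "cosh l + y * sinh l \<le> exp (l\<^sup>2 / 2 + y * l)"
proof -
  have pos: "cosh l + y * sinh l \<le> exp (l\<^sup>2 / 2 + y * l)" if "l \<ge> 0" "\<bar>y\<bar> \<le> 1" for l y :: real
  proof -
    have *: "exp (2 * l) \<ge> 1" using that by simp
    define w where "w = 1 + (1 + y) / 2 * (exp (2 * l) - 1)"
    have w0: "w > 0"
      unfolding w_def using that * by (intro add_pos_nonneg mult_nonneg_nonneg) auto
    have w: "w = exp l * (cosh l + y * sinh l)"
      by (simp add: w_def cosh_def sinh_def exp_minus field_simps flip: exp_add mult_2)
    have "- (2 * l) * ((1 + y) / 2) + ln w \<le> (2 * l)\<^sup>2 / 8"
      unfolding w_def by (rule Hoeffdings_lemma_aux) (use that in auto)
    then have "ln w \<le> l + (l\<^sup>2 / 2 + y * l)"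
      by (simp add: field_simps power2_eq_square)
    then have "exp (ln w) \<le> exp (l + (l\<^sup>2 / 2 + y * l))"
      by (simp only: exp_le_cancel_iff)
    then have "w \<le> exp l * exp (l\<^sup>2 / 2 + y * l)"
      using w0 by (simp add: exp_add)
    then show ?thesis by (simp add: w)
  qed
  show ?thesis
    using pos[of l y] pos[of "-l" "-y"] assms by (cases "l \<ge> 0") auto
qed

lemma pmf_sign_pmf:
  assumes "q \<in> {0..1}"
  shows "pmf (sign_pmf q) 1 = q" "pmf (sign_pmf q) (- 1) = 1 - q"
proof -
  have "(\<lambda>b. if b then 1 else (- 1 :: int)) -` {1} = {True}"
       "(\<lambda>b. if b then 1 else (- 1 :: int)) -` {- 1} = {False}"
    by (auto split: if_splits)
  then show "pmf (sign_pmf q) 1 = q" "pmf (sign_pmf q) (- 1) = 1 - q"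
    using assms by (simp_all add: sign_pmf_def pmf_map measure_pmf_single)
qed

lemma set_sign_pmf: "set_pmf (sign_pmf q) \<subseteq> {1, - 1}"
  by (auto simp: sign_pmf_def split: if_splits)

lemma abs_sum_signs_le:
  fixes x :: "nat \<Rightarrow> int"
  assumes "\<And>i. i \<in> {1..k} \<Longrightarrow> x i \<in> {1, - 1}"
  shows "\<bar>real_of_int (\<Sum>i=1..k. x i)\<bar> \<le> k"
proof -
  have "\<bar>\<Sum>i=1..k. x i\<bar> \<le> (\<Sum>i=1..k. 1)"
    by (intro order.trans[OF sum_abs] sum_mono) (use assms in force)
  then have "\<bar>\<Sum>i=1..k. x i\<bar> \<le> int k" by simp
  then show ?thesis by linarith
qed

context prob_space
begin

lemma AE_of_distr_pmf:
  assumes "W \<in> measurable M (count_space UNIV)" "distr M (count_space UNIV) W = measure_pmf D"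
  shows "AE \<omega> in M. W \<omega> \<in> set_pmf D"
proof -
  have "AE w in distr M (count_space UNIV) W. w \<in> set_pmf D"
    unfolding assms(2) by (rule AE_pmfI)
  then show ?thesis
    using AE_distrD[OF assms(1)] by blast
qed

text \<open>Point probabilities as expectations, the form in which the product rule for disjoint blocks
  of sources delivers them.\<close>
lemma expectation_indicator_distr_pmf:
  assumes "W \<in> measurable M (count_space UNIV)" "distr M (count_space UNIV) W = measure_pmf D"
  shows "expectation (\<lambda>\<omega>. of_bool (W \<omega> = w) :: real) = pmf D w"
proof -
  have "expectation (\<lambda>\<omega>. of_bool (W \<omega> = w) :: real)
      = integral\<^sup>L (distr M (count_space UNIV) W) (\<lambda>v. of_bool (v = w))"
    by (subst integral_distr[OF assms(1)]) auto
  also have "\<dots> = pmf D w"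
  proof -
    have "(\<lambda>v. of_bool (v = w)) = (indicator {w} :: _ \<Rightarrow> real)"
      by (auto simp: fun_eq_iff indicator_def)
    then show ?thesis
      unfolding assms(2) by (simp add: measure_pmf_single)
  qed
  finally show ?thesis .
qed

text \<open>One new step drawn from the memory \<open>x 1, \<dots>, x k\<close>. Given the past, the new step is a sign
  with mean \<open>(2 * p - 1) / k * (\<Sum>i=1..k. x i)\<close>, so averaging over the pick \<open>W\<close> and the sign \<open>e\<close>
  produces the moment generating function of such a sign. In place of a conditional
  expectation, the product \<open>G * exp (l * Y)\<close> is split according to the finitely many values of
  \<open>(W, e)\<close>, which are independent of \<open>G\<close> and of the memory. The same statement serves for the
  walk, whose memory grows, and for a row of the array, whose memory is frozen.\<close>
lemma memory_step:
  fixes Z :: "'i \<Rightarrow> 'a \<Rightarrow> 'c :: countable" and G :: "'a \<Rightarrow> real" and l :: real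
    and x :: "nat \<Rightarrow> 'a \<Rightarrow> int" and W :: "'a \<Rightarrow> nat" and e Y :: "'a \<Rightarrow> int"
  assumes ind: "indep_vars (\<lambda>_. count_space UNIV) Z I"
    and A: "finite A" "A \<subseteq> I" and ab: "a \<in> I - A" "b \<in> I - A" "a \<noteq> b"
    and G: "G \<in> borel_measurable M" "AE \<omega> in M. 0 \<le> G \<omega> \<and> G \<omega> \<le> B" "determined_by Z A G"
    and k: "k \<ge> 1" and p: "p \<in> {0..1}"
    and x: "\<And>i. i \<in> {1..k} \<Longrightarrow> x i \<in> measurable M (count_space UNIV)"
      "\<And>i. i \<in> {1..k} \<Longrightarrow> AE \<omega> in M. x i \<omega> \<in> {1, - 1}"
      "\<And>i. i \<in> {1..k} \<Longrightarrow> determined_by Z A (x i)"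
    and W: "W \<in> measurable M (count_space UNIV)" "determined_by Z {a} W"
      "distr M (count_space UNIV) W = measure_pmf (pmf_of_set {1..k})"
    and e: "e \<in> measurable M (count_space UNIV)" "determined_by Z {b} e"
      "distr M (count_space UNIV) e = measure_pmf (sign_pmf p)"
    and Y: "Y \<in> measurable M (count_space UNIV)" "AE \<omega> in M. Y \<omega> = e \<omega> * x (W \<omega>) \<omega>"
  shows "expectation (\<lambda>\<omega>. G \<omega> * exp (l * Y \<omega>))
    \<le> exp (l\<^sup>2 / 2) * expectation (\<lambda>\<omega>. G \<omega> * exp (l * (2 * p - 1) / k * (\<Sum>i=1..k. x i \<omega>)))"
proof -
  note [measurable] = G(1) W(1) e(1) Y(1) x(1)
  let ?I = "\<lambda>P. of_bool P :: real"
  have xAE: "AE \<omega> in M. \<forall>i\<in>{1..k}. x i \<omega> \<in> {1, - 1}"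
    using x(2) by (simp add: AE_ball_countable)
  have mean: "\<bar>(2 * p - 1) * real_of_int (\<Sum>i=1..k. x i \<omega>) / k\<bar> \<le> 1"
    if "\<forall>i\<in>{1..k}. x i \<omega> \<in> {1, - 1}" for \<omega>
  proof -
    have "\<bar>real_of_int (\<Sum>i=1..k. x i \<omega>)\<bar> \<le> k"
      using that by (intro abs_sum_signs_le) blast
    moreover have "\<bar>2 * p - 1\<bar> \<le> 1"
      using p by (auto simp: abs_if)
    ultimately have "\<bar>2 * p - 1\<bar> * \<bar>real_of_int (\<Sum>i=1..k. x i \<omega>)\<bar> \<le> 1 * real k"
      by (intro mult_mono) simp_all
    then show ?thesis
      using k by (simp add: abs_mult)
  qed
  have WAE: "AE \<omega> in M. W \<omega> \<in> {1..k}"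
    using AE_of_distr_pmf[OF W(1,3)] k by (simp add: set_pmf_of_set)
  have eAE: "AE \<omega> in M. e \<omega> \<in> {1, - 1}"
    using AE_of_distr_pmf[OF e(1,3)] by eventually_elim (use set_sign_pmf in auto)
  \<comment> \<open>On the event that \<open>W = u\<close> and \<open>e = v\<close>, the integrand equals \<open>H u v\<close>.\<close>
  define H where "H u v \<omega> = G \<omega> * exp (l * (v * x u \<omega>))" for u and v :: int and \<omega>
  have Hm [measurable]: "H u v \<in> borel_measurable M" if "u \<in> {1..k}" for u v
    unfolding H_def using that by measurable
  have Hi: "integrable M (H u v)" if "u \<in> {1..k}" "v \<in> {1, - 1}" for u v
  proof (rule integrable_const_bound)
    show "AE \<omega> in M. norm (H u v \<omega>) \<le> B * exp \<bar>l\<bar>"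
      using G(2) x(2)[OF that(1)]
    proof eventually_elim
      case (elim \<omega>)
      have "exp (l * (v * x u \<omega>)) \<le> exp \<bar>l\<bar>"
        using elim that by auto
      then show ?case
        using elim by (auto simp: H_def abs_mult intro!: mult_mono)
    qed
  qed (use Hm that in auto)
  have prod: "expectation (\<lambda>\<omega>. (?I (W \<omega> = u) * ?I (e \<omega> = v)) * H u v \<omega>)
      = 1 / k * pmf (sign_pmf p) v * expectation (H u v)"
    if u: "u \<in> {1..k}" and v: "v \<in> {1, - 1}" for u v
  proof -
    have iW: "integrable M (\<lambda>\<omega>. ?I (W \<omega> = u))" and ie: "integrable M (\<lambda>\<omega>. ?I (e \<omega> = v))"
      and iWe: "integrable M (\<lambda>\<omega>. ?I (W \<omega> = u) * ?I (e \<omega> = v))"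
      by (rule integrable_const_bound[of _ 1]; (auto | measurable))+
    have dW: "determined_by Z {a} (\<lambda>\<omega>. ?I (W \<omega> = u))"
      by (rule determined_by_comp[OF W(2)])
    have de: "determined_by Z {b} (\<lambda>\<omega>. ?I (e \<omega> = v))"
      by (rule determined_by_comp[OF e(2)])
    have dWe: "determined_by Z {a, b} (\<lambda>\<omega>. ?I (W \<omega> = u) * ?I (e \<omega> = v))"
      using determined_by_comp2[where g = "(*)", OF determined_by_mono[OF dW, of "{a, b}"]
          determined_by_mono[OF de, of "{a, b}"]] by simp
    have dH: "determined_by Z A (H u v)"
      unfolding H_def
      using determined_by_comp2[where g = "\<lambda>y i. y * exp (l * (v * real_of_int i))",
          OF G(3) x(3)[OF u]] by simp
    have "expectation (\<lambda>\<omega>. (?I (W \<omega> = u) * ?I (e \<omega> = v)) * H u v \<omega>)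
        = expectation (\<lambda>\<omega>. ?I (W \<omega> = u) * ?I (e \<omega> = v)) * expectation (H u v)"
      by (rule expectation_mult_determined[OF ind, of "{a, b}" A])
         (use A ab iWe dWe dH Hi u v in auto)
    also have "expectation (\<lambda>\<omega>. ?I (W \<omega> = u) * ?I (e \<omega> = v))
        = expectation (\<lambda>\<omega>. ?I (W \<omega> = u)) * expectation (\<lambda>\<omega>. ?I (e \<omega> = v))"
      by (rule expectation_mult_determined[OF ind, of "{a}" "{b}"])
         (use ab iW ie dW de in auto)
    also have "\<dots> = 1 / k * pmf (sign_pmf p) v"
      using u k unfolding expectation_indicator_distr_pmf[OF W(1,3)]
        expectation_indicator_distr_pmf[OF e(1,3)] by simp
    finally show ?thesis .
  qed
  have "expectation (\<lambda>\<omega>. G \<omega> * exp (l * Y \<omega>))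
      = expectation (\<lambda>\<omega>. \<Sum>u\<in>{1..k}. \<Sum>v\<in>{1, - 1}. (?I (W \<omega> = u) * ?I (e \<omega> = v)) * H u v \<omega>)"
  proof (rule integral_cong_AE)
    show "AE \<omega> in M. G \<omega> * exp (l * Y \<omega>)
        = (\<Sum>u\<in>{1..k}. \<Sum>v\<in>{1, - 1}. (?I (W \<omega> = u) * ?I (e \<omega> = v)) * H u v \<omega>)"
      using Y(2) WAE eAE
    proof eventually_elim
      case (elim \<omega>)
      have "(\<Sum>u\<in>{1..k}. \<Sum>v\<in>{1, - 1}. (?I (W \<omega> = u) * ?I (e \<omega> = v)) * H u v \<omega>)
          = (\<Sum>u\<in>{1..k}. if W \<omega> = u then H u (e \<omega>) \<omega> else 0)"
        using elim by (intro sum.cong) auto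
      also have "\<dots> = H (W \<omega>) (e \<omega>) \<omega>"
        using elim by simp
      finally show ?case using elim by (simp add: H_def)
    qed
  qed (use Hm in measurable)
  also have "\<dots> = (\<Sum>u\<in>{1..k}. \<Sum>v\<in>{1, - 1}. 1 / k * pmf (sign_pmf p) v * expectation (H u v))"
  proof -
    have int: "integrable M (\<lambda>\<omega>. (?I (W \<omega> = u) * ?I (e \<omega> = v)) * H u v \<omega>)"
      if "u \<in> {1..k}" "v \<in> {1, - 1}" for u v
    proof (rule Bochner_Integration.integrable_bound[OF Hi[OF that]])
      note [measurable] = Hm[OF that(1), of v]
      show "(\<lambda>\<omega>. (?I (W \<omega> = u) * ?I (e \<omega> = v)) * H u v \<omega>) \<in> borel_measurable M"
        by measurable
      show "AE \<omega> in M. norm ((?I (W \<omega> = u) * ?I (e \<omega> = v)) * H u v \<omega>) \<le> norm (H u v \<omega>)"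
        by (rule AE_I2) simp
    qed
    have "expectation (\<lambda>\<omega>. \<Sum>u\<in>{1..k}. \<Sum>v\<in>{1, - 1}. (?I (W \<omega> = u) * ?I (e \<omega> = v)) * H u v \<omega>)
        = (\<Sum>u\<in>{1..k}. expectation (\<lambda>\<omega>. \<Sum>v\<in>{1, - 1}. (?I (W \<omega> = u) * ?I (e \<omega> = v)) * H u v \<omega>))"
      by (intro Bochner_Integration.integral_sum Bochner_Integration.integrable_sum int)
    also have "\<dots> = (\<Sum>u\<in>{1..k}. \<Sum>v\<in>{1, - 1}.
        expectation (\<lambda>\<omega>. (?I (W \<omega> = u) * ?I (e \<omega> = v)) * H u v \<omega>))"
      by (intro sum.cong refl Bochner_Integration.integral_sum int)
    also have "\<dots> = (\<Sum>u\<in>{1..k}. \<Sum>v\<in>{1, - 1}. 1 / k * pmf (sign_pmf p) v * expectation (H u v))"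
      by (intro sum.cong refl prod)
    finally show ?thesis .
  qed
  also have "\<dots> = expectation (\<lambda>\<omega>. \<Sum>u\<in>{1..k}. \<Sum>v\<in>{1, - 1}. 1 / k * pmf (sign_pmf p) v * H u v \<omega>)"
  proof -
    have int: "integrable M (\<lambda>\<omega>. 1 / k * pmf (sign_pmf p) v * H u v \<omega>)"
      if "u \<in> {1..k}" "v \<in> {1, - 1}" for u v
      by (rule integrable_mult_right) (rule Hi[OF that])
    have "expectation (\<lambda>\<omega>. \<Sum>u\<in>{1..k}. \<Sum>v\<in>{1, - 1}. 1 / k * pmf (sign_pmf p) v * H u v \<omega>)
        = (\<Sum>u\<in>{1..k}. expectation (\<lambda>\<omega>. \<Sum>v\<in>{1, - 1}. 1 / k * pmf (sign_pmf p) v * H u v \<omega>))"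
      by (intro Bochner_Integration.integral_sum Bochner_Integration.integrable_sum int)
    also have "\<dots> = (\<Sum>u\<in>{1..k}. \<Sum>v\<in>{1, - 1}.
        expectation (\<lambda>\<omega>. 1 / k * pmf (sign_pmf p) v * H u v \<omega>))"
      by (intro sum.cong refl Bochner_Integration.integral_sum int)
    finally show ?thesis by simp
  qed
  also have "\<dots> \<le> expectation (\<lambda>\<omega>. exp (l\<^sup>2 / 2) *
      (G \<omega> * exp (l * (2 * p - 1) / k * (\<Sum>i=1..k. x i \<omega>))))"
  proof (rule integral_mono_AE)
    show "integrable M (\<lambda>\<omega>. exp (l\<^sup>2 / 2) * (G \<omega> * exp (l * (2 * p - 1) / k * (\<Sum>i=1..k. x i \<omega>))))"
    proof (rule integrable_const_bound)
      show "AE \<omega> in M. norm (exp (l\<^sup>2 / 2) *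
          (G \<omega> * exp (l * (2 * p - 1) / k * (\<Sum>i=1..k. x i \<omega>)))) \<le> exp (l\<^sup>2 / 2) * (B * exp \<bar>l\<bar>)"
        using G(2) xAE
      proof eventually_elim
        case (elim \<omega>)
        have "\<bar>l\<bar> * \<bar>(2 * p - 1) * (\<Sum>i=1..k. x i \<omega>) / k\<bar> \<le> \<bar>l\<bar> * 1"
          using elim by (intro mult_left_mono mean) auto
        then have "\<bar>l * (2 * p - 1) / k * (\<Sum>i=1..k. x i \<omega>)\<bar> \<le> \<bar>l\<bar>"
          by (simp only: abs_mult abs_divide times_divide_eq_left times_divide_eq_right mult_1_right mult.assoc)
        then have "exp (l * (2 * p - 1) / k * (\<Sum>i=1..k. x i \<omega>)) \<le> exp \<bar>l\<bar>"
          unfolding exp_le_cancel_iff by (rule abs_le_D1)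
        then show ?case
          using elim by (auto simp: abs_mult intro!: mult_mono)
      qed
    qed (unfold of_int_sum, measurable)
    show "AE \<omega> in M. (\<Sum>u\<in>{1..k}. \<Sum>v\<in>{1, - 1}. 1 / k * pmf (sign_pmf p) v * H u v \<omega>)
        \<le> exp (l\<^sup>2 / 2) * (G \<omega> * exp (l * (2 * p - 1) / k * (\<Sum>i=1..k. x i \<omega>)))"
      using G(2) xAE
    proof eventually_elim
      case (elim \<omega>)
      let ?s = "real_of_int (\<Sum>i=1..k. x i \<omega>)" and ?a = "2 * p - 1"
      have one: "p * exp (l * x u \<omega>) + (1 - p) * exp (- (l * x u \<omega>))
          = cosh l + ?a * x u \<omega> * sinh l" if "u \<in> {1..k}" for u
      proof -
        have "x u \<omega> = 1 \<or> x u \<omega> = - 1" using elim that by blast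
        then show ?thesis
          by (elim disjE) (simp_all add: cosh_def sinh_def field_simps)
      qed
      have "(\<Sum>u\<in>{1..k}. \<Sum>v\<in>{1, - 1}. 1 / k * pmf (sign_pmf p) v * H u v \<omega>)
          = (\<Sum>u\<in>{1..k}. G \<omega> / k * (p * exp (l * x u \<omega>) + (1 - p) * exp (- (l * x u \<omega>))))"
        by (intro sum.cong refl) (simp add: pmf_sign_pmf[OF p] H_def field_simps)
      also have "\<dots> = (\<Sum>u\<in>{1..k}. G \<omega> / k * (cosh l + ?a * x u \<omega> * sinh l))"
        by (intro sum.cong refl) (simp only: one)
      also have "\<dots> = G \<omega> * (cosh l + (?a * ?s / k) * sinh l)"
      proof -
        have alg: "r * (g / r * c) + g / r * a * h * s = g * (c + a * s / r * h)"
          if "r \<noteq> 0" for r g c a h s :: real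
          using that by (simp add: field_simps)
        have "(\<Sum>u\<in>{1..k}. G \<omega> / k * (cosh l + ?a * x u \<omega> * sinh l))
            = (\<Sum>u\<in>{1..k}. G \<omega> / k * cosh l + G \<omega> / k * ?a * sinh l * x u \<omega>)"
          by (intro sum.cong refl) (simp only: algebra_simps)
        also have "\<dots> = k * (G \<omega> / k * cosh l) + G \<omega> / k * ?a * sinh l * ?s"
          unfolding sum.distrib sum_distrib_left[symmetric] of_int_sum[symmetric] by simp
        also have "\<dots> = G \<omega> * (cosh l + (?a * ?s / k) * sinh l)"
          using k by (intro alg) simp
        finally show ?thesis .
      qed
      also have "\<dots> \<le> G \<omega> * exp (l\<^sup>2 / 2 + (?a * ?s / k) * l)"
        using elim by (intro mult_left_mono cosh_add_sinh_le_exp mean) auto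
      also have "\<dots> = exp (l\<^sup>2 / 2) * (G \<omega> * exp (l * ?a / k * ?s))"
        unfolding exp_add by (simp only: ac_simps times_divide_eq_left times_divide_eq_right)
      finally show ?case .
    qed
  qed (intro Bochner_Integration.integrable_sum integrable_mult_right Hi)
  also have "\<dots> = exp (l\<^sup>2 / 2) * expectation (\<lambda>\<omega>. G \<omega> * exp (l * (2 * p - 1) / k * (\<Sum>i=1..k. x i \<omega>)))"
    by simp
  finally show ?thesis .
qed

end

section \<open>Subgaussian tails and almost sure convergence\<close>

text \<open>The recursion that the second moment of the walk would satisfy if each new step multiplied the
  old sum by \<open>1 + a / n\<close> and added independent unit noise. Since \<open>a / 0 = 0\<close>, the value at \<open>1\<close>
  is \<open>1\<close>.\<close>
primrec variance_proxy :: "real \<Rightarrow> nat \<Rightarrow> real" where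
  "variance_proxy a 0 = 0"
| "variance_proxy a (Suc n) = 1 + (1 + a / n)\<^sup>2 * variance_proxy a n"

lemma variance_proxy_nonneg: "0 \<le> variance_proxy a n"
  by (induction n) auto

text \<open>To first order the recursion is \<open>v' = 1 + 2 * a * v / n\<close>, whose solutions grow like the larger of
  \<open>n\<close> and \<open>n powr (2 * a)\<close>, with a logarithm at \<open>a = 1/2\<close>. An exponent \<open>d\<close> strictly above both
  makes \<open>C * n powr d\<close> a supersolution and hides the logarithm.\<close>
lemma variance_proxy_growth:
  assumes a: "\<bar>a\<bar> \<le> 1" and d: "d > max 1 (2 * a)"
  obtains C where "C > 0" "eventually (\<lambda>n. variance_proxy a n \<le> C * real n powr d) sequentially"
proof -
  define r where "r = (d - 2 * a) / 2"
  have r: "r > 0" using d by (simp add: r_def)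
  obtain N :: nat where N: "real N \<ge> max 1 (1 / r)"
    using real_arch_simple by blast
  define C where "C = variance_proxy a N + 1 / r"
  have C: "C \<ge> 1 / r" "C > 0" "variance_proxy a N \<le> C"
    using r variance_proxy_nonneg[of a N] by (auto simp: C_def intro!: add_nonneg_pos)
  have "variance_proxy a n \<le> C * real n powr d" if "n \<ge> N" for n
    using that
  proof (induction n rule: dec_induct)
    case base
    have "1 \<le> real N powr d" using N d by (intro ge_one_powr_ge_zero) auto
    then have "C * 1 \<le> C * real N powr d" using C by (intro mult_left_mono) auto
    then show ?case using C by linarith
  next
    case (step n)
    define x where "x = real n"
    have x: "x \<ge> 1" "x \<ge> 1 / r" using step N by (auto simp: x_def)
    have rx: "1 \<le> r * x" using x r by (simp add: field_simps)
    have p1: "1 \<le> x powr (d - 1)" using x d by (intro ge_one_powr_ge_zero) auto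
    have xd: "x powr d = x * x powr (d - 1)"
      using x by (simp add: powr_diff)
    \<comment> \<open>The linear terms leave room for \<open>d - 2 * a = 2 * r\<close>: one half absorbs the
      quadratic term, the other half the additive constant.\<close>
    have quad: "(1 + a / x)\<^sup>2 \<le> 1 + (2 * a + r) / x"
    proof -
      have "a\<^sup>2 \<le> 1" using a by (simp add: abs_square_le_1)
      then have "a\<^sup>2 / x\<^sup>2 \<le> 1 / x\<^sup>2" by (intro divide_right_mono) auto
      also have "\<dots> \<le> r * x / x\<^sup>2" using rx by (intro divide_right_mono) auto
      also have "\<dots> = r / x" using x by (simp add: power2_eq_square)
      finally have "a\<^sup>2 / x\<^sup>2 \<le> r / x" .
      then show ?thesis
        by (simp add: power2_sum power_divide add_divide_distrib)
    qed
    have bern: "x powr d * (1 + d / x) \<le> (x + 1) powr d"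
    proof -
      have "\<exists>z. x < z \<and> z < x + 1 \<and>
          (x + 1) powr d - x powr d = (x + 1 - x) * (d * z powr (d - 1))"
        by (rule MVT2) (use x in \<open>auto intro!: derivative_eq_intros simp: field_simps powr_diff\<close>)
      then obtain z where z: "x < z" "(x + 1) powr d - x powr d = d * z powr (d - 1)"
        by auto
      have "d * x powr (d - 1) \<le> d * z powr (d - 1)"
        using z d x by (intro mult_left_mono powr_mono2) auto
      moreover have "x powr d * (1 + d / x) = x powr d + d * x powr (d - 1)"
        using x by (simp add: xd field_simps)
      ultimately show ?thesis
        using z(2) by linarith
    qed
    have "variance_proxy a (Suc n) = 1 + (1 + a / x)\<^sup>2 * variance_proxy a n"
      by (simp add: x_def)
    also have "\<dots> \<le> 1 + (1 + (2 * a + r) / x) * (C * x powr d)"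
      using quad step.IH C x by (intro add_mono mult_mono order.refl)
        (auto simp: x_def variance_proxy_nonneg intro: order.trans[OF zero_le_power2 quad[unfolded x_def]])
    also have "\<dots> \<le> C * r * x powr (d - 1) + (1 + (2 * a + r) / x) * (C * x powr d)"
    proof -
      have "1 * 1 \<le> C * r * x powr (d - 1)"
        using C r p1 by (intro mult_mono) (auto simp: field_simps)
      then show ?thesis by simp
    qed
    also have "\<dots> = C * (x powr d * (1 + (2 * a + 2 * r) / x))"
      using x by (simp add: xd field_simps)
    also have "2 * a + 2 * r = d" by (simp add: r_def field_simps)
    also have "C * (x powr d * (1 + d / x)) \<le> C * (x + 1) powr d"
      using bern C by (intro mult_left_mono) auto
    also have "x + 1 = real (Suc n)" by (simp add: x_def)
    finally show ?case .
  qed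
  then have "eventually (\<lambda>n. variance_proxy a n \<le> C * real n powr d) sequentially"
    by (rule eventually_sequentiallyI)
  with C that show ?thesis by blast
qed

lemma summable_exp_neg_powr:
  assumes "c > 0" "q > 0"
  shows "summable (\<lambda>n. exp (- c * real n powr q))"
proof (rule summable_comparison_test_ev)
  have "((\<lambda>x. x\<^sup>2 * exp (- c * x powr q)) \<longlongrightarrow> 0) at_top" for x :: real
    using assms by real_asymp
  then have "(\<lambda>n. (real n)\<^sup>2 * exp (- c * real n powr q)) \<longlonglongrightarrow> 0"
    by (rule filterlim_compose) (rule filterlim_real_sequentially)
  then have "eventually (\<lambda>n. (real n)\<^sup>2 * exp (- c * real n powr q) < 1) sequentially"
    by (rule order_tendstoD) simp
  then show "eventually (\<lambda>n. norm (exp (- c * real n powr q)) \<le> 1 / (real n)\<^sup>2) sequentially"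
    using eventually_gt_at_top[of 0] by eventually_elim (simp add: field_simps)
  show "summable (\<lambda>n. 1 / (real n)\<^sup>2)"
    using inverse_power_summable[of 2, where 'a = real] by (simp add: field_simps)
qed

context prob_space
begin

text \<open>Chernoff's bound with the optimal parameter \<open>t / v\<close>, for \<open>Y\<close> and for \<open>- Y\<close>.\<close>
lemma subgaussian_tail:
  fixes Y :: "'a \<Rightarrow> real"
  assumes int: "\<And>l. integrable M (\<lambda>\<omega>. exp (l * Y \<omega>))"
    and mgf: "\<And>l. expectation (\<lambda>\<omega>. exp (l * Y \<omega>)) \<le> K * exp (l\<^sup>2 * v / 2)"
    and v: "v > 0" and t: "t > 0"
    and Y: "Y \<in> borel_measurable M"
  shows "prob {\<omega> \<in> space M. \<bar>Y \<omega>\<bar> \<ge> t} \<le> 2 * K * exp (- t\<^sup>2 / (2 * v))"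
proof -
  note [measurable] = Y
  have one: "prob {\<omega> \<in> space M. s * Y \<omega> \<ge> t} \<le> K * exp (- t\<^sup>2 / (2 * v))" if s: "\<bar>s\<bar> = 1" for s
  proof -
    have i: "integrable M (\<lambda>\<omega>. exp (t / v * (s * Y \<omega>)))"
      using int[of "t / v * s"] by (simp only: mult.assoc)
    have si: "set_integrable M (space M) (\<lambda>\<omega>. exp (t / v * (s * Y \<omega>)))"
      unfolding set_integrable_def by (rule integrable_mult_indicator[OF sets.top i])
    have "prob {\<omega> \<in> space M. s * Y \<omega> \<ge> t}
        \<le> exp (- (t / v) * t) * (\<integral>\<omega>\<in>space M. exp (t / v * (s * Y \<omega>)) \<partial>M)"
      using v t by (intro Chernoff_ineq_ge si) simp_all
    also have "(\<integral>\<omega>\<in>space M. exp (t / v * (s * Y \<omega>)) \<partial>M) = expectation (\<lambda>\<omega>. exp ((t / v * s) * Y \<omega>))"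
      unfolding set_integral_space[OF i] by (simp only: mult.assoc)
    also have "exp (- (t / v) * t) * \<dots> \<le> exp (- (t / v) * t) * (K * exp ((t / v * s)\<^sup>2 * v / 2))"
      by (intro mult_left_mono mgf) simp
    also have "\<dots> = K * exp (- (t / v) * t + (t / v * s)\<^sup>2 * v / 2)"
      by (simp only: exp_add mult.left_commute)
    also have "(t / v * s)\<^sup>2 = (t / v)\<^sup>2"
      using s by (metis mult.right_neutral power2_abs power_mult_distrib power_one)
    also have "- (t / v) * t + (t / v)\<^sup>2 * v / 2 = - t\<^sup>2 / (2 * v)"
      using v by (simp add: field_simps power2_eq_square)
    finally show ?thesis .
  qed
  have "prob {\<omega> \<in> space M. \<bar>Y \<omega>\<bar> \<ge> t}
      \<le> prob ({\<omega> \<in> space M. 1 * Y \<omega> \<ge> t} \<union> {\<omega> \<in> space M. - 1 * Y \<omega> \<ge> t})"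
    by (rule finite_measure_mono) auto
  also have "\<dots> \<le> prob {\<omega> \<in> space M. 1 * Y \<omega> \<ge> t} + prob {\<omega> \<in> space M. - 1 * Y \<omega> \<ge> t}"
    by (rule measure_Un_le) measurable
  also have "\<dots> \<le> K * exp (- t\<^sup>2 / (2 * v)) + K * exp (- t\<^sup>2 / (2 * v))"
    using one[of 1] one[of "- 1"] by (intro add_mono) simp_all
  finally show ?thesis by simp
qed

text \<open>The hypothesis \<open>growth\<close> says that \<open>b n\<close> exceeds the typical size \<open>sqrt (v n)\<close> by a power of \<open>n\<close>,
  so the tails at level \<open>\<epsilon> * b n\<close> are stretched exponentials, which are summable, and the
  Borel-Cantelli lemma applies.\<close>
lemma subgaussian_AE_tendsto_0:
  fixes Y :: "nat \<Rightarrow> 'a \<Rightarrow> real" and b v :: "nat \<Rightarrow> real"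
  assumes Y: "\<And>n. Y n \<in> borel_measurable M"
    and int: "\<And>n l. integrable M (\<lambda>\<omega>. exp (l * Y n \<omega>))"
    and mgf: "\<And>n l. n \<ge> 1 \<Longrightarrow> expectation (\<lambda>\<omega>. exp (l * Y n \<omega>)) \<le> K * exp (l\<^sup>2 * v n / 2)"
    and pos: "\<And>n. n \<ge> 1 \<Longrightarrow> v n > 0" "\<And>n. n \<ge> 1 \<Longrightarrow> b n > 0"
    and growth: "eventually (\<lambda>n. v n * real n powr q \<le> C * (b n)\<^sup>2) sequentially"
    and C: "C > 0" "q > 0" and K: "K \<ge> 0"
  shows "AE \<omega> in M. (\<lambda>n. Y n \<omega> / b n) \<longlonglongrightarrow> 0"
proof -
  note [measurable] = Y
  have small: "AE \<omega> in M. eventually (\<lambda>n. \<bar>Y n \<omega>\<bar> < \<epsilon> * b n) sequentially" if \<epsilon>: "\<epsilon> > 0" for \<epsilon> :: real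
  proof -
    define A where "A n = {\<omega> \<in> space M. \<bar>Y n \<omega>\<bar> \<ge> \<epsilon> * b n}" for n
    have [measurable]: "A n \<in> sets M" for n
      unfolding A_def by measurable
    have "eventually (\<lambda>n. norm (prob (A n)) \<le> 2 * K * exp (- (\<epsilon>\<^sup>2 / (2 * C)) * real n powr q)) sequentially"
      using growth eventually_ge_at_top[of 1]
    proof eventually_elim
      case (elim n)
      have "prob (A n) \<le> 2 * K * exp (- (\<epsilon> * b n)\<^sup>2 / (2 * v n))"
        unfolding A_def using elim pos[of n] \<epsilon> by (intro subgaussian_tail int mgf Y) auto
      also have "\<dots> \<le> 2 * K * exp (- (\<epsilon>\<^sup>2 / (2 * C)) * real n powr q)"
      proof -
        have "\<epsilon>\<^sup>2 / (2 * C * v n) * (v n * real n powr q) \<le> \<epsilon>\<^sup>2 / (2 * C * v n) * (C * (b n)\<^sup>2)"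
          using elim C pos(1)[of n] by (intro mult_left_mono) auto
        then have "\<epsilon>\<^sup>2 / (2 * C) * real n powr q \<le> (\<epsilon> * b n)\<^sup>2 / (2 * v n)"
          using C pos(1)[of n] elim by (simp add: power_mult_distrib field_simps)
        then show ?thesis
          using K by (intro mult_left_mono) auto
      qed
      finally show ?case by simp
    qed
    moreover have "summable (\<lambda>n. 2 * K * exp (- (\<epsilon>\<^sup>2 / (2 * C)) * real n powr q))"
      using \<epsilon> C by (intro summable_mult summable_exp_neg_powr) auto
    ultimately have "summable (\<lambda>n. prob (A n))"
      by (rule summable_comparison_test_ev)
    then have "AE \<omega> in M. eventually (\<lambda>n. \<omega> \<in> space M - A n) sequentially"
      by (intro borel_cantelli_AE1) (auto simp: emeasure_eq_measure)
    then show ?thesis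
      by eventually_elim (auto simp: A_def not_le elim!: eventually_mono)
  qed
  have "AE \<omega> in M. \<forall>j::nat. eventually (\<lambda>n. \<bar>Y n \<omega>\<bar> < 1 / Suc j * b n) sequentially"
    by (subst AE_all_countable) (intro allI small, simp)
  then show ?thesis
  proof eventually_elim
    case (elim \<omega>)
    show ?case
    proof (rule tendstoI)
      fix r :: real assume "r > 0"
      then obtain j where j: "inverse (real (Suc j)) < r"
        using reals_Archimedean by blast
      have "eventually (\<lambda>n. \<bar>Y n \<omega>\<bar> < 1 / Suc j * b n) sequentially" using elim by blast
      then show "eventually (\<lambda>n. dist (Y n \<omega> / b n) 0 < r) sequentially"
        using eventually_ge_at_top[of 1]
      proof eventually_elim
        case (elim n)
        then have "\<bar>Y n \<omega> / b n\<bar> < inverse (real (Suc j))"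
          using pos(2)[of n] by (simp add: abs_divide field_simps)
        with j show ?case by simp
      qed
    qed
  qed
qed

end

section \<open>Moment generating functions of the walk and of the rows\<close>

lemma (in prob_space) integrable_exp_bounded:
  assumes "Y \<in> borel_measurable M" "AE \<omega> in M. \<bar>Y \<omega>\<bar> \<le> (B :: real)"
  shows "integrable M (\<lambda>\<omega>. exp (l * Y \<omega>))"
proof (rule integrable_const_bound)
  show "AE \<omega> in M. norm (exp (l * Y \<omega>)) \<le> exp (\<bar>l\<bar> * B)"
    using assms(2)
  proof eventually_elim
    case (elim \<omega>)
    have "l * Y \<omega> \<le> \<bar>l\<bar> * \<bar>Y \<omega>\<bar>" by (simp flip: abs_mult)
    also have "\<dots> \<le> \<bar>l\<bar> * B" using elim by (intro mult_left_mono) auto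
    finally show ?case by simp
  qed
qed (use assms(1) in measurable)

context elephant_array
begin

abbreviation "source_val \<equiv> source_var X U \<epsilon> V \<delta>"

definition walk_sum :: "nat \<Rightarrow> 'a \<Rightarrow> int" where
  "walk_sum n \<omega> = (\<Sum>i=1..n. X i \<omega>)"

text \<open>\<open>V n k\<close> is positive only almost surely, and \<open>X 0\<close> may fail to be measurable; the maximum with
  \<open>1\<close> changes the step on a null set and makes it a random variable.\<close>
definition row_value :: "nat \<Rightarrow> nat \<Rightarrow> 'a \<Rightarrow> int" where
  "row_value n k \<omega> = \<delta> n k \<omega> * X (max 1 (V n k \<omega>)) \<omega>"

definition row_sum :: "nat \<Rightarrow> nat \<Rightarrow> 'a \<Rightarrow> int" where
  "row_sum n N \<omega> = (\<Sum>k\<in>{m n<..m n + N}. row_value n k \<omega>)"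

text \<open>Step \<open>i\<close> of the walk is built from picks and signs with indices below \<open>i\<close>, so \<open>Pick n\<close> and
  \<open>Sign n\<close> are still fresh when step \<open>n + 1\<close> is drawn.\<close>
definition walk_sources :: "nat \<Rightarrow> source set" where
  "walk_sources n = {Start} \<union> Pick ` {1..<n} \<union> Sign ` {1..<n}"

lemma finite_walk_sources: "finite (walk_sources n)" and walk_sources_subset: "walk_sources n \<subseteq> sources m"
  and walk_sources_mono: "i \<le> n \<Longrightarrow> walk_sources i \<subseteq> walk_sources n"
  by (auto simp: walk_sources_def sources_def)

lemma source_measurable: "i \<in> sources m \<Longrightarrow> source_val i \<in> measurable M (count_space UNIV)"
  using indep_sources by (simp add: indep_vars_def2)

lemma nat_source_measurable:
  assumes "(\<lambda>\<omega>. int (W \<omega>)) \<in> measurable M (count_space UNIV)"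
  shows "W \<in> measurable M (count_space UNIV)"
  using measurable_compose[OF assms measurable_count_space, of nat] by simp

lemma U_measurable: "n \<ge> 1 \<Longrightarrow> U n \<in> measurable M (count_space UNIV)"
  using source_measurable[of "Pick n"] by (intro nat_source_measurable) (auto simp: sources_def)

lemma \<epsilon>_measurable: "n \<ge> 1 \<Longrightarrow> \<epsilon> n \<in> measurable M (count_space UNIV)"
  using source_measurable[of "Sign n"] by (auto simp: sources_def)

lemma V_measurable:
  "n \<ge> 1 \<Longrightarrow> m n < k \<Longrightarrow> k \<le> n \<Longrightarrow> V n k \<in> measurable M (count_space UNIV)"
  using source_measurable[of "Row_Pick n k"] by (intro nat_source_measurable) (auto simp: sources_def)

lemma \<delta>_measurable:
  "n \<ge> 1 \<Longrightarrow> m n < k \<Longrightarrow> k \<le> n \<Longrightarrow> \<delta> n k \<in> measurable M (count_space UNIV)"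
  using source_measurable[of "Row_Sign n k"] by (auto simp: sources_def)

lemma AE_sign:
  assumes "W \<in> measurable M (count_space UNIV)" "distr M (count_space UNIV) W = measure_pmf (sign_pmf q)"
  shows "AE \<omega> in M. W \<omega> \<in> {1, - 1}"
  using AE_of_distr_pmf[OF assms] by eventually_elim (use set_sign_pmf in auto)

lemma AE_uniform:
  fixes W :: "'a \<Rightarrow> nat"
  assumes "W \<in> measurable M (count_space UNIV)" "k \<ge> 1"
    "distr M (count_space UNIV) W = measure_pmf (pmf_of_set {1..k})"
  shows "AE \<omega> in M. W \<omega> \<in> {1..k}"
proof -
  have "set_pmf (pmf_of_set {1..k}) = {1..k}"
    using assms(2) by (intro set_pmf_of_set) auto
  then show ?thesis
    using AE_of_distr_pmf[OF assms(1,3)] by simp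
qed

lemma AE_X_sign: "k \<ge> 1 \<Longrightarrow> AE \<omega> in M. X k \<omega> \<in> {1, - 1}"
proof (induction k rule: less_induct)
  case (less k)
  show ?case
  proof (cases "k = 1")
    case True
    then show ?thesis using AE_sign[OF X_measurable distr_X1] by simp
  next
    case False
    then have "k = (k - 1) + 1" "k - 1 \<ge> 1" using less.prems by auto
    then obtain n where n: "k = n + 1" "n \<ge> 1" by blast
    have "AE \<omega> in M. \<forall>i\<in>{1..n}. X i \<omega> \<in> {1, - 1}"
      using less.IH n by (simp add: AE_ball_countable)
    moreover have "AE \<omega> in M. \<epsilon> n \<omega> \<in> {1, - 1}"
      using n by (intro AE_sign[OF \<epsilon>_measurable distr_\<epsilon>])
    moreover have "AE \<omega> in M. U n \<omega> \<in> {1..n}"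
      using n by (intro AE_uniform[OF U_measurable _ distr_U])
    ultimately show ?thesis
      using X_step[OF n(2)] unfolding n(1)
    proof eventually_elim
      case (elim \<omega>)
      then have "X (U n \<omega>) \<omega> \<in> {1, - 1}" by blast
      with elim show ?case by auto
    qed
  qed
qed

lemma X_determined: "k \<ge> 1 \<Longrightarrow> determined_by source_val (walk_sources k) (X k)"
proof (induction k rule: less_induct)
  case (less k)
  show ?case
  proof (cases "k = 1")
    case True
    then show ?thesis
      using determined_by_source[of Start "walk_sources k" source_val "\<lambda>x. x"] by (simp add: walk_sources_def)
  next
    case False
    then have "k = (k - 1) + 1" "k - 1 \<ge> 1" using less.prems by auto
    then obtain n where n: "k = n + 1" "n \<ge> 1" by blast
    have "determined_by source_val (walk_sources k) (X i)" if "i \<in> {1..n}" for i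
      using less.IH[of i] that n by (intro determined_by_mono[OF _ walk_sources_mono[of i k]]) auto
    then have X: "determined_by source_val (walk_sources k) (\<lambda>\<omega>. restrict (\<lambda>i. X i \<omega>) {1..n})"
      by (intro determined_by_family) auto
    have U: "determined_by source_val (walk_sources k) (U n)"
      using determined_by_source[of "Pick n" "walk_sources k" source_val nat] n by (simp add: walk_sources_def)
    have \<epsilon>: "determined_by source_val (walk_sources k) (\<epsilon> n)"
      using determined_by_source[of "Sign n" "walk_sources k" source_val "\<lambda>x. x"] n by (simp add: walk_sources_def)
    have XU: "determined_by source_val (walk_sources k) (\<lambda>\<omega>. \<epsilon> n \<omega> * restrict (\<lambda>i. X i \<omega>) {1..n} (U n \<omega>))"
      using determined_by_comp2[where g = "(*)", OF \<epsilon> determined_by_comp2[where g = "\<lambda>r u. r u", OF X U]] .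
    have "AE \<omega> in M. U n \<omega> \<in> {1..n}"
      using n by (intro AE_uniform[OF U_measurable _ distr_U])
    with X_step[OF n(2)]
    have "AE \<omega> in M. X k \<omega> = \<epsilon> n \<omega> * restrict (\<lambda>i. X i \<omega>) {1..n} (U n \<omega>)"
      unfolding n(1) by eventually_elim simp
    then show ?thesis
      by (rule determined_by_cong_AE[OF XU])
  qed
qed

lemma X_determined_mono: "1 \<le> i \<Longrightarrow> i \<le> n \<Longrightarrow> determined_by source_val (walk_sources n) (X i)"
  by (rule determined_by_mono[OF X_determined walk_sources_mono])

lemma walk_sum_determined: "determined_by source_val (walk_sources n) (walk_sum n)"
proof -
  have "determined_by source_val (walk_sources n) (\<lambda>\<omega>. restrict (\<lambda>i. X i \<omega>) {1..n})"
    by (intro determined_by_family X_determined_mono) auto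
  from determined_by_comp[OF this, of "\<lambda>r. \<Sum>i=1..n. r i"] show ?thesis
    by (simp add: walk_sum_def[abs_def])
qed

lemma walk_sum_measurable [measurable]: "(\<lambda>\<omega>. real_of_int (walk_sum n \<omega>)) \<in> borel_measurable M"
  unfolding walk_sum_def of_int_sum using X_measurable by measurable

lemma AE_abs_walk_sum_le: "AE \<omega> in M. \<bar>real_of_int (walk_sum n \<omega>)\<bar> \<le> n"
proof -
  have "AE \<omega> in M. \<forall>i\<in>{1..n}. X i \<omega> \<in> {1, - 1}"
    using AE_X_sign by (simp add: AE_ball_countable)
  then show ?thesis
    by eventually_elim (unfold walk_sum_def, rule abs_sum_signs_le, blast)
qed

text \<open>By the memory step, passing from \<open>n\<close> to \<open>n + 1\<close> costs a factor \<open>exp (l\<^sup>2 / 2)\<close> and replaces \<open>l\<close> by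
  \<open>l * (1 + (2 * p - 1) / n)\<close>; this is the recursion of the variance proxy. The walk is not centred
  because \<open>X 1\<close> need not be. The factor \<open>exp (1 / 2)\<close> pays for this once, at the start, through
  \<open>\<bar>l\<bar> \<le> 1 / 2 + l\<^sup>2 / 2\<close>.\<close>
lemma walk_mgf:
  fixes l :: real
  assumes p: "p \<in> {0..1}" and n: "n \<ge> 1"
  shows "expectation (\<lambda>\<omega>. exp (l * walk_sum n \<omega>))
    \<le> exp (1 / 2) * exp (l\<^sup>2 * variance_proxy (2 * p - 1) n / 2)"
  using n
proof (induction n arbitrary: l rule: dec_induct)
  case base
  have "expectation (\<lambda>\<omega>. exp (l * walk_sum 1 \<omega>)) \<le> expectation (\<lambda>_. exp (1 / 2) * exp (l\<^sup>2 / 2))"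
  proof (rule integral_mono_AE)
    show "integrable M (\<lambda>\<omega>. exp (l * walk_sum 1 \<omega>))"
      by (rule integrable_exp_bounded[OF walk_sum_measurable AE_abs_walk_sum_le])
    show "AE \<omega> in M. exp (l * walk_sum 1 \<omega>) \<le> exp (1 / 2) * exp (l\<^sup>2 / 2)"
      using AE_abs_walk_sum_le[of 1]
    proof eventually_elim
      case (elim \<omega>)
      have "0 \<le> (1 - \<bar>l\<bar>)\<^sup>2" by simp
      then have "\<bar>l\<bar> * 1 \<le> 1 / 2 + l\<^sup>2 / 2" by (simp add: power2_diff)
      moreover have "l * walk_sum 1 \<omega> \<le> \<bar>l\<bar> * \<bar>real_of_int (walk_sum 1 \<omega>)\<bar>"
        by (simp flip: abs_mult)
      moreover have "\<bar>l\<bar> * \<bar>real_of_int (walk_sum 1 \<omega>)\<bar> \<le> \<bar>l\<bar> * 1"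
        using elim by (intro mult_left_mono) auto
      ultimately have "l * walk_sum 1 \<omega> \<le> 1 / 2 + l\<^sup>2 / 2" by linarith
      then show ?case by (simp flip: exp_add)
    qed
  qed simp
  then show ?case by (simp add: prob_space)
next
  case (step n)
  let ?a = "2 * p - 1"
  have n: "n \<ge> 1" using step by simp
  have "expectation (\<lambda>\<omega>. exp (l * walk_sum (Suc n) \<omega>))
      = expectation (\<lambda>\<omega>. exp (l * walk_sum n \<omega>) * exp (l * X (n + 1) \<omega>))"
    by (simp add: walk_sum_def distrib_left exp_add)
  also have "\<dots> \<le> exp (l\<^sup>2 / 2) *
      expectation (\<lambda>\<omega>. exp (l * walk_sum n \<omega>) * exp (l * ?a / n * (\<Sum>i=1..n. X i \<omega>)))"
  proof (rule memory_step[OF indep_sources finite_walk_sources walk_sources_subset[of n],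
        where a = "Pick n" and b = "Sign n" and W = "U n" and e = "\<epsilon> n"])
    show "AE \<omega> in M. 0 \<le> exp (l * walk_sum n \<omega>) \<and> exp (l * walk_sum n \<omega>) \<le> exp (\<bar>l\<bar> * n)"
      using AE_abs_walk_sum_le[of n]
    proof eventually_elim
      case (elim \<omega>)
      have "l * walk_sum n \<omega> \<le> \<bar>l\<bar> * \<bar>real_of_int (walk_sum n \<omega>)\<bar>"
        by (simp flip: abs_mult)
      also have "\<dots> \<le> \<bar>l\<bar> * n"
        using elim by (intro mult_left_mono) auto
      finally show ?case by simp
    qed
    show "determined_by source_val (walk_sources n) (\<lambda>\<omega>. exp (l * walk_sum n \<omega>))"
      by (rule determined_by_comp[OF walk_sum_determined, where g = "\<lambda>s. exp (l * real_of_int s)"])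
    show "determined_by source_val {Pick n} (U n)"
      using determined_by_source[of "Pick n" "{Pick n}" source_val nat] by simp
    show "determined_by source_val {Sign n} (\<epsilon> n)"
      using determined_by_source[of "Sign n" "{Sign n}" source_val "\<lambda>x. x"] by simp
    show "AE \<omega> in M. X (n + 1) \<omega> = \<epsilon> n \<omega> * X (U n \<omega>) \<omega>"
      by (rule X_step[OF n])
    show "distr M (count_space UNIV) (U n) = measure_pmf (pmf_of_set {1..n})"
      by (rule distr_U[OF n])
    show "distr M (count_space UNIV) (\<epsilon> n) = measure_pmf (sign_pmf p)"
      by (rule distr_\<epsilon>[OF n])
  qed (use n p X_measurable AE_X_sign X_determined_mono U_measurable \<epsilon>_measurable in
        \<open>auto simp: sources_def walk_sources_def\<close>)
  also have "expectation (\<lambda>\<omega>. exp (l * walk_sum n \<omega>) * exp (l * ?a / n * (\<Sum>i=1..n. X i \<omega>)))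
      = expectation (\<lambda>\<omega>. exp ((l * (1 + ?a / n)) * walk_sum n \<omega>))"
    unfolding walk_sum_def[symmetric] by (simp add: algebra_simps flip: exp_add)
  also have "exp (l\<^sup>2 / 2) * \<dots>
      \<le> exp (l\<^sup>2 / 2) * (exp (1 / 2) * exp ((l * (1 + ?a / n))\<^sup>2 * variance_proxy ?a n / 2))"
    using step.IH by (intro mult_left_mono) auto
  also have "\<dots> = exp (1 / 2) * exp (l\<^sup>2 * variance_proxy ?a (Suc n) / 2)"
  proof -
    have "exp (x / 2) * (exp (1 / 2) * exp (x * y * z / 2)) = exp (1 / 2) * exp (x * (1 + y * z) / 2)"
      for x y z :: real
      by (simp add: algebra_simps add_divide_distrib flip: exp_add)
    then show ?thesis
      unfolding variance_proxy.simps power_mult_distrib .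
  qed
  finally show ?case .
qed

definition row_sources :: "nat \<Rightarrow> nat \<Rightarrow> source set" where
  "row_sources n N = walk_sources (m n) \<union> Row_Pick n ` {m n<..m n + N} \<union> Row_Sign n ` {m n<..m n + N}"

text \<open>The part of row \<open>n\<close> beyond the walk, minus its conditional mean given the walk.\<close>
definition row_noise :: "nat \<Rightarrow> 'a \<Rightarrow> real" where
  "row_noise n \<omega> = row_sum n (n - m n) \<omega>
    - real (n - m n) * ((2 * p - 1) / m n) * walk_sum (m n) \<omega>"

lemma finite_row_sources: "finite (row_sources n N)"
  by (simp add: row_sources_def finite_walk_sources)

lemma row_sources_subset: "n \<ge> 1 \<Longrightarrow> m n + N \<le> n \<Longrightarrow> row_sources n N \<subseteq> sources m"
  using walk_sources_subset[of "m n"] by (auto simp: row_sources_def sources_def)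

context
  fixes n :: nat
  assumes n: "n \<ge> 1" and m: "1 \<le> m n" "m n \<le> n"
begin

lemma AE_row_value:
  assumes k: "m n < k" "k \<le> n"
  shows "AE \<omega> in M. V n k \<omega> \<in> {1..m n}"
    and "AE \<omega> in M. row_value n k \<omega> = \<delta> n k \<omega> * X (V n k \<omega>) \<omega>"
    and "AE \<omega> in M. row_value n k \<omega> \<in> {1, - 1}"
proof -
  show V: "AE \<omega> in M. V n k \<omega> \<in> {1..m n}"
    by (intro AE_uniform V_measurable distr_V n m k)
  then show eq: "AE \<omega> in M. row_value n k \<omega> = \<delta> n k \<omega> * X (V n k \<omega>) \<omega>"
    by eventually_elim (simp add: row_value_def)
  have "AE \<omega> in M. \<forall>i\<in>{1..m n}. X i \<omega> \<in> {1, - 1}"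
    using AE_X_sign by (simp add: AE_ball_countable)
  moreover have "AE \<omega> in M. \<delta> n k \<omega> \<in> {1, - 1}"
    by (rule AE_sign[OF \<delta>_measurable[OF n k] distr_\<delta>[OF n k]])
  ultimately show "AE \<omega> in M. row_value n k \<omega> \<in> {1, - 1}"
    using V eq
  proof eventually_elim
    case (elim \<omega>)
    then have "X (V n k \<omega>) \<omega> \<in> {1, - 1}" by blast
    with elim show ?case by auto
  qed
qed

lemma row_value_measurable:
  assumes k: "m n < k" "k \<le> n"
  shows "row_value n k \<in> measurable M (count_space UNIV)"
proof -
  have "(\<lambda>\<omega>. X (max 1 (V n k \<omega>)) \<omega>) \<in> measurable M (count_space UNIV)"
    by (rule measurable_compose_countable[where f = "\<lambda>i. X (max 1 i)"])
       (auto intro: X_measurable V_measurable n k)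
  with \<delta>_measurable[OF n k] show ?thesis
    unfolding row_value_def[abs_def] by measurable
qed

lemma row_sum_measurable:
  "m n + N \<le> n \<Longrightarrow> (\<lambda>\<omega>. real_of_int (row_sum n N \<omega>)) \<in> borel_measurable M"
  unfolding row_sum_def of_int_sum
  by (intro borel_measurable_sum measurable_compose[OF row_value_measurable]) auto

lemma row_value_determined:
  assumes k: "m n < k" "k \<le> m n + N" "m n + N \<le> n"
  shows "determined_by source_val (row_sources n N) (row_value n k)"
proof -
  have X: "determined_by source_val (row_sources n N) (\<lambda>\<omega>. restrict (\<lambda>i. X i \<omega>) {1..m n})"
    by (intro determined_by_family determined_by_mono[OF X_determined_mono[where n = "m n"]])
       (auto simp: row_sources_def)
  have V: "determined_by source_val (row_sources n N) (V n k)"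
    using determined_by_source[of "Row_Pick n k" "row_sources n N" source_val nat] k
    by (simp add: row_sources_def)
  have \<delta>: "determined_by source_val (row_sources n N) (\<delta> n k)"
    using determined_by_source[of "Row_Sign n k" "row_sources n N" source_val "\<lambda>x. x"] k
    by (simp add: row_sources_def)
  have XV: "determined_by source_val (row_sources n N)
      (\<lambda>\<omega>. \<delta> n k \<omega> * restrict (\<lambda>i. X i \<omega>) {1..m n} (V n k \<omega>))"
    using determined_by_comp2[where g = "(*)", OF \<delta> determined_by_comp2[where g = "\<lambda>r u. r u", OF X V]] .
  have "k \<le> n" using k by simp
  from AE_row_value(1)[OF k(1) this] AE_row_value(2)[OF k(1) this]
  have "AE \<omega> in M. row_value n k \<omega> = \<delta> n k \<omega> * restrict (\<lambda>i. X i \<omega>) {1..m n} (V n k \<omega>)"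
    by eventually_elim simp
  then show ?thesis
    by (rule determined_by_cong_AE[OF XV])
qed

lemma row_sum_determined:
  assumes "m n + N \<le> n"
  shows "determined_by source_val (row_sources n N) (row_sum n N)"
proof -
  have "determined_by source_val (row_sources n N) (\<lambda>\<omega>. restrict (\<lambda>k. row_value n k \<omega>) {m n<..m n + N})"
    by (intro determined_by_family row_value_determined) (use assms in auto)
  from determined_by_comp[OF this, of "\<lambda>r. \<Sum>k\<in>{m n<..m n + N}. r k"] show ?thesis
    by (simp add: row_sum_def[abs_def])
qed

lemma AE_abs_row_sum_le:
  assumes "m n + N \<le> n"
  shows "AE \<omega> in M. \<bar>real_of_int (row_sum n N \<omega>)\<bar> \<le> N"
proof -
  have "AE \<omega> in M. \<forall>k\<in>{m n<..m n + N}. row_value n k \<omega> \<in> {1, - 1}"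
    using AE_row_value(3) assms by (simp add: AE_ball_countable)
  then show ?thesis
  proof eventually_elim
    case (elim \<omega>)
    have "\<bar>row_sum n N \<omega>\<bar> \<le> (\<Sum>k\<in>{m n<..m n + N}. 1)"
      unfolding row_sum_def by (intro order.trans[OF sum_abs] sum_mono) (use elim in force)
    then show ?case by simp
  qed
qed

text \<open>Each position of the row contributes a factor \<open>exp (l\<^sup>2 / 2)\<close> and moves its conditional mean, a
  multiple of the walk at time \<open>m n\<close>, into the first coefficient. That coefficient is kept
  arbitrary for the induction, and so that it can later be chosen to cancel these means.\<close>
lemma row_mgf:
  fixes c l :: real
  assumes p: "p \<in> {0..1}" and N: "m n + N \<le> n"
  shows "expectation (\<lambda>\<omega>. exp (c * walk_sum (m n) \<omega> + l * row_sum n N \<omega>))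
    \<le> exp (N * (l\<^sup>2 / 2)) *
      expectation (\<lambda>\<omega>. exp ((c + N * (l * (2 * p - 1) / m n)) * walk_sum (m n) \<omega>))"
  using N
proof (induction N arbitrary: c)
  case 0
  then show ?case by (simp add: row_sum_def)
next
  case (Suc N)
  let ?a = "2 * p - 1" and ?k = "Suc (m n + N)"
  have N: "m n + N \<le> n" and k: "m n < ?k" "?k \<le> n" using Suc.prems by auto
  note [measurable] = row_sum_measurable[OF N]
  define G where "G \<omega> = exp (c * walk_sum (m n) \<omega> + l * row_sum n N \<omega>)" for \<omega>
  have "{m n<..m n + Suc N} = insert ?k {m n<..m n + N}" by auto
  then have "expectation (\<lambda>\<omega>. exp (c * walk_sum (m n) \<omega> + l * row_sum n (Suc N) \<omega>))
      = expectation (\<lambda>\<omega>. G \<omega> * exp (l * row_value n ?k \<omega>))"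
    by (simp add: row_sum_def G_def algebra_simps flip: exp_add)
  also have "\<dots> \<le> exp (l\<^sup>2 / 2) * expectation (\<lambda>\<omega>. G \<omega> * exp (l * ?a / m n * (\<Sum>i=1..m n. X i \<omega>)))"
  proof (rule memory_step[OF indep_sources finite_row_sources row_sources_subset[OF n N],
        where a = "Row_Pick n ?k" and b = "Row_Sign n ?k" and W = "V n ?k" and e = "\<delta> n ?k"])
    show "AE \<omega> in M. 0 \<le> G \<omega> \<and> G \<omega> \<le> exp (\<bar>c\<bar> * m n + \<bar>l\<bar> * N)"
      using AE_abs_walk_sum_le[of "m n"] AE_abs_row_sum_le[OF N]
    proof eventually_elim
      case (elim \<omega>)
      have "c * walk_sum (m n) \<omega> \<le> \<bar>c\<bar> * \<bar>real_of_int (walk_sum (m n) \<omega>)\<bar>"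
        "l * row_sum n N \<omega> \<le> \<bar>l\<bar> * \<bar>real_of_int (row_sum n N \<omega>)\<bar>"
        by (simp_all flip: abs_mult)
      moreover have "\<bar>c\<bar> * \<bar>real_of_int (walk_sum (m n) \<omega>)\<bar> \<le> \<bar>c\<bar> * m n"
        "\<bar>l\<bar> * \<bar>real_of_int (row_sum n N \<omega>)\<bar> \<le> \<bar>l\<bar> * N"
        using elim by (auto intro!: mult_left_mono)
      ultimately have "c * walk_sum (m n) \<omega> + l * row_sum n N \<omega> \<le> \<bar>c\<bar> * m n + \<bar>l\<bar> * N"
        by linarith
      then show ?case by (simp add: G_def)
    qed
    have "determined_by source_val (row_sources n N) (walk_sum (m n))"
      by (rule determined_by_mono[OF walk_sum_determined]) (auto simp: row_sources_def)
    from determined_by_comp2[where g = "\<lambda>x y. exp (c * real_of_int x + l * real_of_int y)",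
        OF this row_sum_determined[OF N]]
    show "determined_by source_val (row_sources n N) G"
      by (simp add: G_def[abs_def])
    show "determined_by source_val {Row_Pick n ?k} (V n ?k)"
      using determined_by_source[of "Row_Pick n ?k" "{Row_Pick n ?k}" source_val nat] by simp
    show "determined_by source_val {Row_Sign n ?k} (\<delta> n ?k)"
      using determined_by_source[of "Row_Sign n ?k" "{Row_Sign n ?k}" source_val "\<lambda>x. x"] by simp
    show "determined_by source_val (row_sources n N) (X i)" if "i \<in> {1..m n}" for i
      using that by (intro determined_by_mono[OF X_determined_mono[of i "m n"]])
        (auto simp: row_sources_def)
    show "distr M (count_space UNIV) (V n ?k) = measure_pmf (pmf_of_set {1..m n})"
      by (rule distr_V[OF n k])
    show "distr M (count_space UNIV) (\<delta> n ?k) = measure_pmf (sign_pmf p)"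
      by (rule distr_\<delta>[OF n k])
    show "AE \<omega> in M. row_value n ?k \<omega> = \<delta> n ?k \<omega> * X (V n ?k \<omega>) \<omega>"
      by (rule AE_row_value(2)[OF k])
    show "G \<in> borel_measurable M"
      unfolding G_def by measurable
    show "row_value n ?k \<in> measurable M (count_space UNIV)"
      by (rule row_value_measurable[OF k])
    show "V n ?k \<in> measurable M (count_space UNIV)" "\<delta> n ?k \<in> measurable M (count_space UNIV)"
      by (rule V_measurable[OF n k], rule \<delta>_measurable[OF n k])
    show "Row_Pick n ?k \<in> sources m - row_sources n N" "Row_Sign n ?k \<in> sources m - row_sources n N"
      using n k by (auto simp: sources_def row_sources_def walk_sources_def)
  qed (use m p X_measurable AE_X_sign in auto)
  also have "expectation (\<lambda>\<omega>. G \<omega> * exp (l * ?a / m n * (\<Sum>i=1..m n. X i \<omega>)))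
      = expectation (\<lambda>\<omega>. exp ((c + l * ?a / m n) * walk_sum (m n) \<omega> + l * row_sum n N \<omega>))"
    unfolding walk_sum_def[symmetric] G_def exp_add[symmetric] by (simp only: distrib_right add_ac)
  also have "exp (l\<^sup>2 / 2) * \<dots> \<le> exp (l\<^sup>2 / 2) * (exp (N * (l\<^sup>2 / 2)) *
      expectation (\<lambda>\<omega>. exp ((c + l * ?a / m n + N * (l * ?a / m n)) * walk_sum (m n) \<omega>)))"
    using Suc.IH[OF N] by (intro mult_left_mono) auto
  also have "\<dots> = exp (Suc N * (l\<^sup>2 / 2)) *
      expectation (\<lambda>\<omega>. exp ((c + Suc N * (l * ?a / m n)) * walk_sum (m n) \<omega>))"
  proof -
    have "c + r + N * r = c + Suc N * r" for r :: real
      by (simp add: algebra_simps)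
    moreover have "exp r * (exp (N * r) * y) = exp (Suc N * r) * y" for r y :: real
      by (simp add: distrib_right exp_add)
    ultimately show ?thesis by (simp only:)
  qed
  finally show ?case .
qed

text \<open>The first coefficient in the preceding lemma is chosen so that the walk disappears on the
  right-hand side.\<close>
lemma row_noise_mgf:
  assumes p: "p \<in> {0..1}"
  shows "expectation (\<lambda>\<omega>. exp (l * row_noise n \<omega>)) \<le> exp (l\<^sup>2 * n / 2)"
proof -
  let ?N = "n - m n"
  have "expectation (\<lambda>\<omega>. exp (l * row_noise n \<omega>))
      = expectation (\<lambda>\<omega>. exp (- (?N * (l * (2 * p - 1) / m n)) * walk_sum (m n) \<omega> + l * row_sum n ?N \<omega>))"
    by (simp add: row_noise_def algebra_simps)
  also have "\<dots> \<le> exp (?N * (l\<^sup>2 / 2))"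
    using row_mgf[OF p, of ?N "- (?N * (l * (2 * p - 1) / m n))" l] m
    by (simp add: prob_space)
  also have "\<dots> \<le> exp (l\<^sup>2 * n / 2)"
    using mult_right_mono[of "real ?N" n "l\<^sup>2 / 2"] by (simp add: mult.commute)
  finally show ?thesis .
qed

lemma row_noise_measurable: "row_noise n \<in> borel_measurable M"
proof -
  have [measurable]: "(\<lambda>\<omega>. real_of_int (row_sum n (n - m n) \<omega>)) \<in> borel_measurable M"
    by (rule row_sum_measurable) (use m in simp)
  show ?thesis
    unfolding row_noise_def[abs_def] by measurable
qed

lemma row_noise_integrable: "integrable M (\<lambda>\<omega>. exp (l * row_noise n \<omega>))"
proof (rule integrable_exp_bounded[OF row_noise_measurable])
  let ?r = "real (n - m n) * ((2 * p - 1) / m n)"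
  have "m n + (n - m n) \<le> n" using m by simp
  from AE_abs_row_sum_le[OF this] AE_abs_walk_sum_le[of "m n"]
  show "AE \<omega> in M. \<bar>row_noise n \<omega>\<bar> \<le> real (n - m n) + \<bar>?r\<bar> * m n"
  proof eventually_elim
    case (elim \<omega>)
    have "\<bar>?r * walk_sum (m n) \<omega>\<bar> \<le> \<bar>?r\<bar> * m n"
      unfolding abs_mult using elim by (intro mult_left_mono) auto
    with elim(1) show ?case unfolding row_noise_def by linarith
  qed
qed

lemma AE_array_walk:
  "AE \<omega> in M. real_of_int (array_walk m X V \<delta> n \<omega>)
    = row_noise n \<omega> + (1 + real (n - m n) * ((2 * p - 1) / m n)) * walk_sum (m n) \<omega>"
proof -
  have "AE \<omega> in M. \<forall>k\<in>{m n<..n}. row_value n k \<omega> = \<delta> n k \<omega> * X (V n k \<omega>) \<omega>"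
    using AE_row_value(2) by (simp add: AE_ball_countable)
  then show ?thesis
  proof eventually_elim
    case (elim \<omega>)
    have split: "{1..n} = {1..m n} \<union> {m n<..n}" using m by auto
    have "array_walk m X V \<delta> n \<omega>
        = (\<Sum>k=1..m n. array_step m X V \<delta> n k \<omega>) + (\<Sum>k\<in>{m n<..n}. array_step m X V \<delta> n k \<omega>)"
      unfolding array_walk_def split by (intro sum.union_disjoint) auto
    also have "\<dots> = walk_sum (m n) \<omega> + row_sum n (n - m n) \<omega>"
      unfolding walk_sum_def row_sum_def using elim m
      by (intro arg_cong2[where f = "(+)"] sum.cong) (auto simp: array_step_def)
    finally show ?case by (simp add: row_noise_def algebra_simps)
  qed
qed

end

end

section \<open>Almost sure convergence of the array walk\<close>

context elephant_array
begin

lemma AE_walk_sum_div_powr_tendsto_0: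
  assumes p: "p \<in> {0..1}" and c: "max (2 * p - 1) (1/2) < c"
  shows "AE \<omega> in M. (\<lambda>n. walk_sum n \<omega> / real n powr c) \<longlonglongrightarrow> 0"
proof -
  let ?a = "2 * p - 1"
  \<comment> \<open>The exponent \<open>d\<close> bounds the variance proxy and leaves \<open>n powr (2 * c - d)\<close> to spare.\<close>
  define d where "d = (max 1 (2 * ?a) + 2 * c) / 2"
  have "max 1 (2 * ?a) < 2 * c" using c by simp
  moreover have "x < (x + y) / 2 \<and> (x + y) / 2 < y" if "x < y" for x y :: real
    using that by simp
  ultimately have d: "max 1 (2 * ?a) < d" "d < 2 * c"
    unfolding d_def by blast+
  have "\<bar>?a\<bar> \<le> 1" using p by (auto simp: abs_if)
  from variance_proxy_growth[OF this d(1)] obtain C where C: "C > 0"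
    "eventually (\<lambda>n. variance_proxy ?a n \<le> C * real n powr d) sequentially" .
  show ?thesis
  proof (rule subgaussian_AE_tendsto_0[where v = "variance_proxy ?a" and K = "exp (1/2)"
        and q = "2 * c - d" and C = C])
    show "integrable M (\<lambda>\<omega>. exp (l * walk_sum n \<omega>))" for n and l :: real
      by (rule integrable_exp_bounded[OF walk_sum_measurable AE_abs_walk_sum_le])
    show "variance_proxy ?a n > 0" if "n \<ge> 1" for n
      using that by (cases n) (auto intro!: add_pos_nonneg mult_nonneg_nonneg variance_proxy_nonneg)
    show "eventually (\<lambda>n. variance_proxy ?a n * real n powr (2 * c - d)
        \<le> C * (real n powr c)\<^sup>2) sequentially"
      using C(2) eventually_ge_at_top[of 1]
    proof eventually_elim
      case (elim n)
      have "variance_proxy ?a n * real n powr (2 * c - d)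
          \<le> C * real n powr d * real n powr (2 * c - d)"
        using elim by (intro mult_right_mono) auto
      also have "\<dots> = C * (real n powr d * real n powr (2 * c - d))" by simp
      also have "real n powr d * real n powr (2 * c - d) = real n powr c * real n powr c"
        unfolding powr_add[symmetric] by simp
      finally show ?case by (simp add: power2_eq_square)
    qed
  qed (use walk_mgf[OF p] C d in auto)
qed

text \<open>The noise of row \<open>n\<close> has variance proxy \<open>n\<close>, while the normalisation is at least \<open>n powr c\<close>, because
  \<open>m n \<le> n\<close> and \<open>c < 1\<close>. The Borel-Cantelli lemma thus runs over \<open>n\<close> and not over the values of
  \<open>m n\<close>, which may repeat arbitrarily often.\<close>
lemma AE_row_noise_tendsto_0:
  assumes p: "p \<in> {0..1}" and c: "1/2 < c" "c < 1"
    and m: "\<And>n. n \<ge> 1 \<Longrightarrow> 1 \<le> m n \<and> m n \<le> n"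
  shows "AE \<omega> in M. (\<lambda>n. row_noise n \<omega> / (real n * real (m n) powr (c - 1))) \<longlonglongrightarrow> 0"
proof -
  have zero: "row_noise 0 = (\<lambda>_. 0)"
    by (simp add: row_noise_def[abs_def] row_sum_def)
  show ?thesis
  proof (rule subgaussian_AE_tendsto_0[where v = real and K = 1 and q = "2 * c - 1" and C = 1])
    show "row_noise n \<in> borel_measurable M" for n
      using row_noise_measurable[of n] m[of n] zero by (cases "n = 0") auto
    show "integrable M (\<lambda>\<omega>. exp (l * row_noise n \<omega>))" for n l
      using row_noise_integrable[of n l] m[of n] zero by (cases "n = 0") auto
    show "expectation (\<lambda>\<omega>. exp (l * row_noise n \<omega>)) \<le> 1 * exp (l\<^sup>2 * real n / 2)" if "n \<ge> 1" for n l
      using row_noise_mgf[of n l] m[of n] that p by simp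
    show "real n * real (m n) powr (c - 1) > 0" if "n \<ge> 1" for n
      using m[OF that] that by simp
    show "eventually (\<lambda>n. real n * real n powr (2 * c - 1)
        \<le> 1 * (real n * real (m n) powr (c - 1))\<^sup>2) sequentially"
      using eventually_ge_at_top[of 1]
    proof eventually_elim
      case (elim n)
      have "real n powr (c - 1) \<le> real (m n) powr (c - 1)"
        using m[OF elim] c by (intro powr_mono2') auto
      then have "(real n * real n powr (c - 1))\<^sup>2 \<le> (real n * real (m n) powr (c - 1))\<^sup>2"
        by (intro power_mono mult_left_mono) auto
      moreover have "(real n * real n powr (c - 1))\<^sup>2 = real n * (real n * (real n powr (c - 1) * real n powr (c - 1)))"
        by (simp add: power2_eq_square)
      moreover have "real n powr (2 * c - 1) = real n powr (1 + ((c - 1) + (c - 1)))"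
        by simp
      then have "real n powr (2 * c - 1) = real n * (real n powr (c - 1) * real n powr (c - 1))"
        using elim unfolding powr_add by simp
      ultimately show ?case by simp
    qed
  qed (use c in auto)
qed

text \<open>With \<open>r = m n / n\<close> and \<open>a = 2 * p - 1\<close>, the scaled walk is the scaled noise plus
  \<open>r + (1 - r) * a\<close> times the walk at time \<open>m n\<close> divided by \<open>m n powr c\<close>. That coefficient lies in
  \<open>[- 1, 1]\<close>.\<close>
lemma AE_scaled_array_walk_tendsto_0:
  assumes p: "p \<in> {0..1}" and c: "max (2 * p - 1) (1/2) < c" "c < 1"
    and m: "\<And>n. n \<ge> 1 \<Longrightarrow> 1 \<le> m n \<and> m n \<le> n"
    and m_inf: "filterlim m at_top sequentially"
  shows "AE \<omega> in M. (\<lambda>n. m n / n * array_walk m X V \<delta> n \<omega> / real (m n) powr c) \<longlonglongrightarrow> 0"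
proof -
  let ?a = "2 * p - 1"
  have "AE \<omega> in M. \<forall>n\<in>{1..}. array_walk m X V \<delta> n \<omega>
      = row_noise n \<omega> + (1 + real (n - m n) * (?a / m n)) * walk_sum (m n) \<omega>"
    using AE_array_walk m by (simp add: AE_ball_countable)
  moreover have "AE \<omega> in M. (\<lambda>n. walk_sum n \<omega> / real n powr c) \<longlonglongrightarrow> 0"
    by (rule AE_walk_sum_div_powr_tendsto_0[OF p c(1)])
  moreover have "AE \<omega> in M. (\<lambda>n. row_noise n \<omega> / (real n * real (m n) powr (c - 1))) \<longlonglongrightarrow> 0"
    using c by (intro AE_row_noise_tendsto_0 p m) auto
  ultimately show ?thesis
  proof eventually_elim
    case (elim \<omega>)
    let ?S = "\<lambda>n. walk_sum n \<omega> / real n powr c"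
    let ?D = "\<lambda>n. row_noise n \<omega> / (real n * real (m n) powr (c - 1))"
    have S: "(\<lambda>n. ?S (m n)) \<longlonglongrightarrow> 0"
      by (rule filterlim_compose[OF elim(2) m_inf])
    have lim: "(\<lambda>n. \<bar>?D n\<bar> + \<bar>?S (m n)\<bar>) \<longlonglongrightarrow> 0"
      using tendsto_add[OF tendsto_rabs_zero[OF elim(3)] tendsto_rabs_zero[OF S]]
      by (simp only: add_0_left)
    show ?case
    proof (rule Lim_null_comparison[OF _ lim])
      show "eventually (\<lambda>n. norm (m n / n * array_walk m X V \<delta> n \<omega> / real (m n) powr c)
          \<le> \<bar>?D n\<bar> + \<bar>?S (m n)\<bar>) sequentially"
        using eventually_ge_at_top[of 1]
      proof eventually_elim
        case n: (elim n)
        define r where "r = real (m n) / real n"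
        have r: "0 < r" "r \<le> 1" using m[OF n] n by (auto simp: r_def)
        have coeff: "r * (1 + real (n - m n) * (?a / m n)) = r + (1 - r) * ?a"
          using m[OF n] n by (simp add: r_def of_nat_diff field_simps)
        have "r + (1 - r) * ?a \<le> r + (1 - r) * 1"
          using p r by (intro add_left_mono mult_left_mono) auto
        moreover have "r + (1 - r) * ?a \<ge> 0 + (1 - r) * (- 1)"
          using p r by (intro add_mono mult_left_mono) auto
        ultimately have bound: "\<bar>r + (1 - r) * ?a\<bar> \<le> 1"
          using r by (simp add: abs_le_iff)
        have mc: "real (m n) powr c = m n * real (m n) powr (c - 1)"
          using m[OF n] by (simp add: powr_diff)
        have noise: "r * row_noise n \<omega> / real (m n) powr c = ?D n"
          using m[OF n] n by (simp add: r_def mc)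
        have "array_walk m X V \<delta> n \<omega>
            = row_noise n \<omega> + (1 + real (n - m n) * (?a / m n)) * walk_sum (m n) \<omega>"
          using elim(1) n by simp
        moreover have "g * (x + q * y) / z = g * x / z + g * q * (y / z)" for g x q y z :: real
          by (simp add: algebra_simps add_divide_distrib)
        ultimately have "r * array_walk m X V \<delta> n \<omega> / real (m n) powr c
            = r * row_noise n \<omega> / real (m n) powr c
              + r * (1 + real (n - m n) * (?a / m n)) * ?S (m n)"
          by (simp only:)
        then have "r * array_walk m X V \<delta> n \<omega> / real (m n) powr c
            = ?D n + (r + (1 - r) * ?a) * ?S (m n)"
          by (simp only: coeff noise)
        moreover have "\<bar>(r + (1 - r) * ?a) * ?S (m n)\<bar> \<le> 1 * \<bar>?S (m n)\<bar>"
          unfolding abs_mult using bound by (intro mult_right_mono) auto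
        moreover have "\<bar>y\<bar> \<le> \<bar>x\<bar> + \<bar>z\<bar>" if "y = x + w" "\<bar>w\<bar> \<le> 1 * \<bar>z\<bar>" for w x y z :: real
          using that by linarith
        ultimately show ?case
          unfolding r_def[symmetric] real_norm_def by blast
      qed
    qed
  qed
qed

end

theorem theorem2p3:
  fixes M :: "'a measure" and p s \<alpha> \<gamma> :: real
    and m :: "nat \<Rightarrow> nat" and \<gamma>\<^sub>n :: "nat \<Rightarrow> real"
    and X :: "nat \<Rightarrow> 'a \<Rightarrow> int"
    and U :: "nat \<Rightarrow> 'a \<Rightarrow> nat" and \<epsilon> :: "nat \<Rightarrow> 'a \<Rightarrow> int"
    and V :: "nat \<Rightarrow> nat \<Rightarrow> 'a \<Rightarrow> nat" and \<delta> :: "nat \<Rightarrow> nat \<Rightarrow> 'a \<Rightarrow> int"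
    and T :: "nat \<Rightarrow> 'a \<Rightarrow> int"
  assumes "p \<in> {0<..<1}" and "s \<in> {0..1}" and "\<alpha> = 2 * p - 1"
    and "\<And>n. n \<ge> 1 \<Longrightarrow> 1 \<le> m n \<and> m n \<le> n"
    and "filterlim m at_top sequentially"
    and "\<And>n. n \<ge> 1 \<Longrightarrow> \<gamma>\<^sub>n n = real (m n) / real n"
    and "\<gamma>\<^sub>n \<longlonglongrightarrow> \<gamma>" and "\<gamma> \<in> {0..1}"
    and "elephant_array M p s m X U \<epsilon> V \<delta>"
    and "T = array_walk m X V \<delta>"
  shows "(AE \<omega> in M. (\<lambda>n. real_of_int (T n \<omega>) / real n) \<longlonglongrightarrow> 0) \<and>
    (\<forall>c. max \<alpha> (1/2) < c \<and> c < 1 \<longrightarrow>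
      (AE \<omega> in M. (\<lambda>n. \<gamma>\<^sub>n n * real_of_int (T n \<omega>) / real (m n) powr c) \<longlonglongrightarrow> 0))"
proof -
  interpret elephant_array M p s m X U \<epsilon> V \<delta> by fact
  have p: "p \<in> {0..1}" using assms(1) by simp
  note m = assms(4)
  have scaled: "AE \<omega> in M. (\<lambda>n. m n / n * T n \<omega> / real (m n) powr c) \<longlonglongrightarrow> 0"
    if "max \<alpha> (1/2) < c" "c < 1" for c
    using AE_scaled_array_walk_tendsto_0[OF p, of c] that m assms(3,5,10) by simp
  show ?thesis
  proof (intro conjI allI impI)
    \<comment> \<open>Any admissible exponent below \<open>1\<close> gives the law of large numbers, since
      \<open>m n powr c \<le> m n\<close>.\<close>
    define c where "c = (1 + max \<alpha> (1/2)) / 2"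
    have c: "max \<alpha> (1/2) < c" "c < 1"
      using assms(1,3) by (auto simp: c_def max_def)
    show "AE \<omega> in M. (\<lambda>n. real_of_int (T n \<omega>) / real n) \<longlonglongrightarrow> 0"
      using scaled[OF c]
    proof eventually_elim
      case (elim \<omega>)
      show ?case
      proof (rule Lim_null_comparison[OF _ tendsto_rabs_zero[OF elim]])
        show "eventually (\<lambda>n. norm (T n \<omega> / real n)
            \<le> \<bar>m n / n * T n \<omega> / real (m n) powr c\<bar>) sequentially"
          using eventually_ge_at_top[of 1]
        proof eventually_elim
          case (elim n)
          have "real (m n) powr c \<le> real (m n) powr 1"
            using m[OF elim] c by (intro powr_mono) auto
          then have "1 \<le> m n / real (m n) powr c"
            using m[OF elim] by simp
          then have "\<bar>T n \<omega> / real n\<bar> * 1 \<le> \<bar>T n \<omega> / real n\<bar> * (m n / real (m n) powr c)"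
            by (intro mult_left_mono) auto
          also have "\<dots> = \<bar>m n / n * T n \<omega> / real (m n) powr c\<bar>"
            by (simp add: abs_mult abs_divide)
          finally show ?case by simp
        qed
      qed
    qed
  next
    fix c assume "max \<alpha> (1/2) < c \<and> c < 1"
    then have "AE \<omega> in M. (\<lambda>n. m n / n * T n \<omega> / real (m n) powr c) \<longlonglongrightarrow> 0"
      by (intro scaled) auto
    then show "AE \<omega> in M. (\<lambda>n. \<gamma>\<^sub>n n * real_of_int (T n \<omega>) / real (m n) powr c) \<longlonglongrightarrow> 0"
    proof eventually_elim
      case (elim \<omega>)
      have "eventually (\<lambda>n. m n / n * T n \<omega> / real (m n) powr c
          = \<gamma>\<^sub>n n * real_of_int (T n \<omega>) / real (m n) powr c) sequentially"
        using eventually_ge_at_top[of 1] by eventually_elim (simp add: assms(6))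
      with elim show ?case
        by (rule Lim_transform_eventually)
    qed
  qed
qed

end
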